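(* Let $k$ be a field, $N\ge 1$ an integer, and $q\in k$ a nonzero element with $q^8\neq 1$. Let $\widetilde{X}=\{x_{ij} : 1\le i<j\le N+1\}$, linearly ordered by $x_{mn}>x_{ij}$ if and only if $(m,n)>(i,j)$ lexicographically, and equip the free monoid $\widetilde{X}^*$ with the corresponding deg-lex order. Let $\widetilde{S}^+\subset k\langle \widetilde{X}\rangle$ be the set of Jimbo relations, i.e. the set of the following polynomials, where $(i,j)$ and $(m,n)$ range over pairs with $1\le i<j\le N+1$ and $1\le m<n\le N+1$: \begin{itemize} \item $x_{mn}x_{ij}-q^{-2}x_{ij}x_{mn}$, if $i=m<j<n$ or $i<m<j=n$; \item $x_{mn}x_{ij}-x_{ij}x_{mn}$, if $i<m<n<j$ or $i<j<m<n$; \item $x_{mn}x_{ij}-x_{ij}x_{mn}+(q^2-q^{-2})x_{in}x_{mj}$, if $i<m<j<n$; \item $x_{mn}x_{ij}-q^2x_{ij}x_{mn}+q\,x_{in}$, if $i<j=m<n$. \end{itemize} Then, with respect to the deg-lex order on $\widetilde{X}^*$, $\widetilde{S}^+$ is a Gröbner–Shirshov basis for $k\langle \widetilde{X}\mid \widetilde{S}^+\rangle=U_q^+(A_N)$.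
   Context: For a set $X$, $X^*$ is the free monoid on $X$ (with empty word $1$) and $k\langle X\rangle$ the free associative unital $k$-algebra on $X$; $k\langle X\mid S\rangle = k\langle X\rangle/\mathrm{Id}(S)$, where $\mathrm{Id}(S)$ is the two-sided ideal generated by $S$. The deg-lex order on $X^*$ (for linearly ordered $X$) compares two words first by length and then lexicographically from left to right. For nonzero $f\in k\langle X\rangle$, $\bar f$ denotes its leading (largest) word; $f$ is monic if the coefficient of $\bar f$ is $1$. Compositions. Let $f,g\in k\langle X\rangle$ be monic. (i) If $w=\bar f b=a\bar g$ for some $a,b\in X^*$ with $\deg(\bar f)+\deg(\bar g)>\deg(w)$, then $(f,g)_w=fb-ag$ is the intersection composition of $f,g$ with respect to $w$. (ii) If $w=\bar f=a\bar g b$ for some $a,b\in X^*$, then $(f,g)_w=f-agb$ is the inclusion composition. For a set $S$ of monic polynomials, $(f,g)_w$ is trivial modulo $(S,w)$ if $(f,g)_w=\sum_i\alpha_i a_is_ib_i$ (finite sum) with $\alpha_i\in k$, $a_i,b_i\in X^*$, $s_i\in S$ and $\overline{a_is_ib_i}<w$ for all $i$. The set $S$ is a Gröbner–Shirshov basis (in $k\langle X\rangle$, equivalently for the algebra $k\langle X\mid S\rangle$) if every composition $(f,g)_w$ of elements $f,g\in S$ is trivial modulo $(S,w)$. The algebra $U_q^+(A_N)$ is the positive part of the Drinfeld–Jimbo quantized enveloping algebra of type $A_N$: the unital associative $k$-algebra generated by $x_1,\dots,x_N$ with defining relations $x_i^2x_j-(q^2+q^{-2})x_ix_jx_i+x_jx_i^2=0$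 for $|i-j|=1$ and $x_ix_j-x_jx_i=0$ for $|i-j|>1$. The Jimbo generators are the elements $x_{i,i+1}=x_i$ and, for $j>i+1$, recursively $x_{ij}=q\,x_{i,j-1}x_{j-1,j}-q^{-1}x_{j-1,j}x_{i,j-1}$. The equality $k\langle\widetilde X\mid\widetilde S^+\rangle=U_q^+(A_N)$ is the identification sending the generator $x_{ij}$ to the element of $U_q^+(A_N)$ of the same name. *)

theory Defs
  imports
    "HOL-Algebra.QuotRing"
    "HOL-Library.Poly_Mapping"
    "HOL-Library.List_Lenlexorder"
    "HOL-Library.Product_Lexorder"
begin

text \<open>
  Words are lists.  Making lists an additive monoid under concatenation turns the finitely
  supported functions \<open>'x list \<Rightarrow>\<^sub>0 'k\<close> into the free associative unital algebra on the
  type \<open>'x\<close>: the product on \<^theory>\<open>HOL-Library.Poly_Mapping\<close> is the convolution product.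
  The order on \<open>'x list\<close> (length first, then lexicographic from the left) is the deg-lex order,
  and the order on \<open>nat \<times> nat\<close> is the lexicographic one.
\<close>

instantiation list :: (type) monoid_add
begin
definition zero_list_def: "0 = ([] :: 'a list)"
definition plus_list_def: "xs + ys = (xs @ ys :: 'a list)"
instance by standard (simp_all add: zero_list_def plus_list_def)
end

type_synonym ('x, 'k) ncpoly = "'x list \<Rightarrow>\<^sub>0 'k"

definition const :: "'k::zero \<Rightarrow> ('x, 'k) ncpoly" where
  "const c = Poly_Mapping.single [] c"

definition word :: "'x list \<Rightarrow> ('x, 'k::zero_neq_one) ncpoly" where
  "word w = Poly_Mapping.single w 1"

definition gen :: "'x \<Rightarrow> ('x, 'k::zero_neq_one) ncpoly" where
  "gen x = word [x]"

definition free_alg :: "'x set \<Rightarrow> ('x, 'k::field) ncpoly ring" where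
  "free_alg X = \<lparr>carrier = {f. Poly_Mapping.keys f \<subseteq> lists X},
     mult = (*), one = 1, zero = 0, add = (+)\<rparr>"

lemma ring_free_alg: "ring (free_alg X :: ('x, 'k::field) ncpoly ring)"
proof -
  have mult: "Poly_Mapping.keys (f * g) \<subseteq> lists X"
    if "Poly_Mapping.keys f \<subseteq> lists X" "Poly_Mapping.keys g \<subseteq> lists X"
    for f g :: "('x, 'k) ncpoly"
    using that keys_mult[of f g] by (fastforce simp: plus_list_def)
  have add: "Poly_Mapping.keys (f + g) \<subseteq> lists X"
    if "Poly_Mapping.keys f \<subseteq> lists X" "Poly_Mapping.keys g \<subseteq> lists X"
    for f g :: "('x, 'k) ncpoly"
    using that Poly_Mapping.keys_add[of f g] by blast
  have one: "Poly_Mapping.keys (1 :: ('x, 'k) ncpoly) \<subseteq> lists X"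
    by (simp add: zero_list_def)
  have neg: "\<exists>g. Poly_Mapping.keys g \<subseteq> lists X \<and> f + g = 0"
    if "Poly_Mapping.keys f \<subseteq> lists X" for f :: "('x, 'k) ncpoly"
    using that by (intro exI[of _ "- f"]) auto
  have "abelian_group (free_alg X :: ('x, 'k) ncpoly ring)"
    by (rule abelian_groupI) (simp_all add: free_alg_def add neg algebra_simps)
  moreover have "monoid (free_alg X :: ('x, 'k) ncpoly ring)"
    by (rule monoidI) (simp_all add: free_alg_def mult one algebra_simps del: keys_one)
  ultimately show ?thesis
    by (rule ringI) (simp_all add: free_alg_def algebra_simps)
qed

definition Id_gen :: "'x set \<Rightarrow> ('x, 'k::field) ncpoly set \<Rightarrow> ('x, 'k) ncpoly set" where
  "Id_gen X S = genideal (free_alg X) S"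

definition pres_alg :: "'x set \<Rightarrow> ('x, 'k::field) ncpoly set \<Rightarrow> ('x, 'k) ncpoly set ring" where
  "pres_alg X S = free_alg X Quot Id_gen X S"

definition cls :: "'x set \<Rightarrow> ('x, 'k::field) ncpoly set \<Rightarrow> ('x, 'k) ncpoly \<Rightarrow> ('x, 'k) ncpoly set" where
  "cls X S f = Id_gen X S +>\<^bsub>free_alg X\<^esub> f"

text \<open>A unital ring isomorphism is \<open>k\<close>-linear iff it fixes the classes of the constants.\<close>

definition pres_alg_iso ::
  "'x set \<Rightarrow> ('x, 'k::field) ncpoly set \<Rightarrow> 'y set \<Rightarrow> ('y, 'k) ncpoly set
    \<Rightarrow> (('x, 'k) ncpoly set \<Rightarrow> ('y, 'k) ncpoly set) set" where
  "pres_alg_iso X S Y T = {\<phi> \<in> ring_iso (pres_alg X S) (pres_alg Y T).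
     \<forall>c. \<phi> (cls X S (const c)) = cls Y T (const c)}"


text \<open>Only meaningful for nonzero polynomials; \<open>0\<close> is not monic.\<close>

definition lead_word :: "('x::linorder, 'k::zero) ncpoly \<Rightarrow> 'x list" where
  "lead_word f = Max (Poly_Mapping.keys f)"

definition monic :: "('x::linorder, 'k::field) ncpoly \<Rightarrow> bool" where
  "monic f \<longleftrightarrow> f \<noteq> 0 \<and> Poly_Mapping.lookup f (lead_word f) = 1"

text \<open>\<open>composition X f g w h\<close>: the polynomial \<open>h\<close> is a composition of \<open>f\<close> and \<open>g\<close>
  with respect to the word \<open>w\<close>.\<close>

inductive composition ::
  "'x::linorder set \<Rightarrow> ('x, 'k::field) ncpoly \<Rightarrow> ('x, 'k) ncpoly
    \<Rightarrow> 'x list \<Rightarrow> ('x, 'k) ncpoly \<Rightarrow> bool"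
  for X f g where
  intersection:
    "\<lbrakk>a \<in> lists X; b \<in> lists X; w = lead_word f @ b; w = a @ lead_word g;
      length (lead_word f) + length (lead_word g) > length w\<rbrakk>
     \<Longrightarrow> composition X f g w (f * word b - word a * g)"
| inclusion:
    "\<lbrakk>a \<in> lists X; b \<in> lists X; w = lead_word f; w = a @ lead_word g @ b\<rbrakk>
     \<Longrightarrow> composition X f g w (f - word a * g * word b)"

definition trivial_mod ::
  "'x::linorder set \<Rightarrow> ('x, 'k::field) ncpoly set \<Rightarrow> 'x list \<Rightarrow> ('x, 'k) ncpoly \<Rightarrow> bool" where
  "trivial_mod X S w h \<longleftrightarrow>
     (\<exists>ts :: ('k \<times> 'x list \<times> ('x, 'k) ncpoly \<times> 'x list) list.
        (\<forall>(\<alpha>, a, s, b) \<in> set ts. a \<in> lists X \<and> b \<in> lists X \<and> s \<in> S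
           \<and> lead_word (word a * s * word b) < w) \<and>
        h = (\<Sum>(\<alpha>, a, s, b) \<leftarrow> ts. const \<alpha> * word a * s * word b))"

definition groebner_shirshov_basis ::
  "'x::linorder set \<Rightarrow> ('x, 'k::field) ncpoly set \<Rightarrow> bool" where
  "groebner_shirshov_basis X S \<longleftrightarrow>
     S \<subseteq> carrier (free_alg X) \<and> (\<forall>s\<in>S. monic s) \<and>
     (\<forall>f\<in>S. \<forall>g\<in>S. \<forall>w h. composition X f g w h \<longrightarrow> trivial_mod X S w h)"


definition uq_gens :: "nat \<Rightarrow> nat set" where
  "uq_gens N = {1..N}"

definition uq_rels :: "nat \<Rightarrow> 'k::field \<Rightarrow> (nat, 'k) ncpoly set" where
  "uq_rels N q =
     {gen i * gen i * gen j - const (q^2 + inverse (q^2)) * gen i * gen j * gen i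
        + gen j * gen i * gen i
      | i j. i \<in> uq_gens N \<and> j \<in> uq_gens N \<and> (j = i + 1 \<or> i = j + 1)}
   \<union> {gen i * gen j - gen j * gen i
      | i j. i \<in> uq_gens N \<and> j \<in> uq_gens N \<and> (i + 1 < j \<or> j + 1 < i)}"

text \<open>Representatives in the free algebra on \<open>x\<^sub>1, \<dots>, x\<^sub>N\<close> of the elements \<open>x\<^sub>i\<^sub>j\<close> of
  \<open>U\<^sub>q\<^sup>+(A\<^sub>N)\<close>; only used for \<open>i < j\<close>.\<close>

function jimbo_gen :: "'k::field \<Rightarrow> nat \<Rightarrow> nat \<Rightarrow> (nat, 'k) ncpoly" where
  "jimbo_gen q i j =
     (if i + 1 < j
      then const q * jimbo_gen q i (j - 1) * jimbo_gen q (j - 1) j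
           - const (inverse q) * jimbo_gen q (j - 1) j * jimbo_gen q i (j - 1)
      else gen i)"
  by pat_completeness auto
termination by (relation "measure (\<lambda>(q, i, j). j - i)") auto

declare jimbo_gen.simps [simp del]

definition jimbo_vars :: "nat \<Rightarrow> (nat \<times> nat) set" where
  "jimbo_vars N = {(i, j). 1 \<le> i \<and> i < j \<and> j \<le> N + 1}"

definition jimbo_rels :: "nat \<Rightarrow> 'k::field \<Rightarrow> (nat \<times> nat, 'k) ncpoly set" where
  "jimbo_rels N q =
     {gen (m, n) * gen (i, j) - const (inverse (q^2)) * gen (i, j) * gen (m, n)
      | i j m n. (i, j) \<in> jimbo_vars N \<and> (m, n) \<in> jimbo_vars N \<and>
          (i = m \<and> m < j \<and> j < n \<or> i < m \<and> m < j \<and> j = n)}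
   \<union> {gen (m, n) * gen (i, j) - gen (i, j) * gen (m, n)
      | i j m n. (i, j) \<in> jimbo_vars N \<and> (m, n) \<in> jimbo_vars N \<and>
          (i < m \<and> m < n \<and> n < j \<or> i < j \<and> j < m \<and> m < n)}
   \<union> {gen (m, n) * gen (i, j) - gen (i, j) * gen (m, n)
        + const (q^2 - inverse (q^2)) * gen (i, n) * gen (m, j)
      | i j m n. (i, j) \<in> jimbo_vars N \<and> (m, n) \<in> jimbo_vars N \<and>
          i < m \<and> m < j \<and> j < n}
   \<union> {gen (m, n) * gen (i, j) - const (q^2) * gen (i, j) * gen (m, n) + const q * gen (i, n)
      | i j m n. (i, j) \<in> jimbo_vars N \<and> (m, n) \<in> jimbo_vars N \<and>
          i < j \<and> j = m \<and> m < n}"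

end

theory Submission
  imports Defs "HOL-Library.Infinite_Set"
begin

text \<open>
  For each pair of generators \<open>x < y\<close> there is exactly one relation, and its leading word is
  \<open>yx\<close>. So only the overlaps \<open>yxz\<close> with \<open>z < x < y\<close> give nonzero compositions. Such an overlap
  involves at most six indices, and the shape of the relations depends only on the relative order of
  the indices. It therefore suffices to reduce to zero the 455 compositions with indices in
  \<open>{0..5}\<close>, a finite computation with coefficients in \<open>\<int>[q, q\<^sup>-\<^sup>1]\<close>.

  For the isomorphism, the Serre relations follow at once from the Jimbo relations. Conversely,
  \<open>x\<^sub>i\<^sub>n = q x\<^sub>i\<^sub>j x\<^sub>j\<^sub>n - q\<^sup>-\<^sup>1 x\<^sub>j\<^sub>n x\<^sub>i\<^sub>j\<close> holds in \<open>U\<^sub>q\<^sup>+(A\<^sub>N)\<close> for all \<open>i < j < n\<close>, which reduces the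
  \<open>q\<close>-commutation of \<open>x\<^sub>i\<^sub>n\<close> with \<open>x\<^sub>i\<^sub>j\<close> and with \<open>x\<^sub>j\<^sub>n\<close> to the Serre relations and to the commutation of
  nested generators. For \<open>i < m < j < n\<close>, expanding \<open>x\<^sub>i\<^sub>j x\<^sub>m\<^sub>n\<close> in two ways gives the relation
  between crossing generators together with \<open>(q\<^sup>2 + q\<^sup>-\<^sup>2) [x\<^sub>m\<^sub>j, x\<^sub>i\<^sub>n] = 0\<close>; here \<open>q\<^sup>8 \<noteq> 1\<close> is used.
\<close>

section \<open>Constants and words in the free algebra\<close>

lemma const_zero [simp]: "const 0 = 0"
  by (simp add: const_def)

lemma const_1 [simp]: "const 1 = 1"
  by (simp add: const_def flip: zero_list_def)

lemma const_uminus: "const (- c) = - const (c :: 'k::field)"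
  by (simp add: const_def single_uminus)

lemma const_diff: "const (c - d) = const c - const (d :: 'k::field)"
  by (simp add: const_def single_diff)

lemma const_add: "const (c + d) = const c + const d"
  by (simp add: const_def single_add)

lemma const_mult: "const (a * b) = const a * const b"
  by (simp add: const_def mult_single plus_list_def)

lemma const_mult_single: "const c * Poly_Mapping.single u d = Poly_Mapping.single u (c * d)"
  by (simp add: const_def mult_single plus_list_def)

lemma word_mult: "word u * word v = (word (u @ v) :: ('x, 'k::field) ncpoly)"
  by (simp add: word_def mult_single plus_list_def)

lemma word_Nil: "word [] = (1 :: ('x, 'k::field) ncpoly)"
  by (simp add: word_def zero_list_def flip: single_one)

lemma word_mult_single:
  "word a * Poly_Mapping.single u (c :: 'k::field) = Poly_Mapping.single (a @ u) c"
  "Poly_Mapping.single u (c :: 'k::field) * word b = Poly_Mapping.single (u @ b) c"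
  by (simp_all add: word_def mult_single plus_list_def)

lemma single_eq_const_word: "Poly_Mapping.single u (c :: 'k::field) = const c * word u"
  by (simp add: word_def const_mult_single)

lemma poly_mapping_sum_single:
  "f = (\<Sum>v\<in>Poly_Mapping.keys f. Poly_Mapping.single v (Poly_Mapping.lookup f v))"
  by (rule poly_mapping_eqI) (simp add: lookup_sum lookup_single when_def in_keys_iff)

lemma const_commute: "f * const (c :: 'k::field) = const c * f"
proof -
  have "(\<Sum>v\<in>K. Poly_Mapping.single v (F v)) * const c = const c * (\<Sum>v\<in>K. Poly_Mapping.single v (F v))"
    for K F
    by (simp add: sum_distrib_left sum_distrib_right const_def mult_single plus_list_def mult.commute)
  then show ?thesis
    by (subst (1 2) poly_mapping_sum_single[of f])
qed

section \<open>Two-sided multiples by words, and the deg-lex order\<close>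

lemma word_sandwich:
  fixes s :: "('x, 'k::field) ncpoly"
  shows "word a * s * word b =
    (\<Sum>v\<in>Poly_Mapping.keys s. Poly_Mapping.single (a @ v @ b) (Poly_Mapping.lookup s v))"
  by (subst poly_mapping_sum_single[of s])
    (simp add: sum_distrib_left sum_distrib_right word_mult_single)

lemma lookup_word_sandwich:
  "Poly_Mapping.lookup (word a * (s :: ('x, 'k::field) ncpoly) * word b) (a @ u @ b) = Poly_Mapping.lookup s u"
  by (simp add: word_sandwich lookup_sum lookup_single when_def in_keys_iff)

text \<open>The map \<open>v \<mapsto> a @ v @ b\<close> is injective, so multiplying by words
  neither merges nor cancels terms.\<close>

lemma keys_word_sandwich:
  "Poly_Mapping.keys (word a * (s :: ('x, 'k::field) ncpoly) * word b) = (\<lambda>v. a @ v @ b) ` Poly_Mapping.keys s"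
proof (intro equalityI subsetI)
  fix w assume "w \<in> Poly_Mapping.keys (word a * s * word b)"
  then have "(\<Sum>v\<in>Poly_Mapping.keys s.
      Poly_Mapping.lookup (Poly_Mapping.single (a @ v @ b) (Poly_Mapping.lookup s v)) w) \<noteq> 0"
    by (simp add: word_sandwich in_keys_iff lookup_sum)
  then obtain v where "v \<in> Poly_Mapping.keys s"
    "Poly_Mapping.lookup (Poly_Mapping.single (a @ v @ b) (Poly_Mapping.lookup s v)) w \<noteq> 0"
    by (rule sum.not_neutral_contains_not_neutral)
  then show "w \<in> (\<lambda>v. a @ v @ b) ` Poly_Mapping.keys s"
    by (auto simp: lookup_single when_def split: if_splits)
next
  fix w assume "w \<in> (\<lambda>v. a @ v @ b) ` Poly_Mapping.keys s"
  then show "w \<in> Poly_Mapping.keys (word a * s * word b)"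
    by (auto simp: in_keys_iff lookup_word_sandwich)
qed

text \<open>This makes deg-lex a monomial order. Comparing lengths first is what makes appending
  \<open>b\<close> harmless: the purely lexicographic order is not preserved by it.\<close>

lemma append_strict_mono: "(u :: 'x::linorder list) < v \<Longrightarrow> a @ u @ b < a @ v @ b"
  by (simp add: list_less_def lenlex_append1 irrefl_def)

lemma append_mono: "(u :: 'x::linorder list) \<le> v \<Longrightarrow> a @ u @ b \<le> a @ v @ b"
  by (metis append_strict_mono le_less)

lemma lead_word_sandwich:
  fixes s :: "('x::linorder, 'k::field) ncpoly"
  assumes "s \<noteq> 0"
  shows "lead_word (word a * s * word b) = a @ lead_word s @ b"
  unfolding lead_word_def keys_word_sandwich
  by (rule Max_eqI) (use assms in \<open>auto intro!: append_mono imageI\<close>)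

section \<open>Triviality modulo \<open>(S, w)\<close> is preserved by linear combinations\<close>

lemma trivial_mod_0: "trivial_mod X S w 0"
  unfolding trivial_mod_def by (rule exI[of _ "[]"]) simp

lemma trivial_mod_add:
  assumes "trivial_mod X S w g" "trivial_mod X S w h"
  shows "trivial_mod X S w (g + h)"
proof -
  obtain ts where ts: "\<forall>(\<alpha>, a, s, b) \<in> set ts. a \<in> lists X \<and> b \<in> lists X \<and> s \<in> S
      \<and> lead_word (word a * s * word b) < w"
    "g = (\<Sum>(\<alpha>, a, s, b) \<leftarrow> ts. const \<alpha> * word a * s * word b)"
    using assms(1) unfolding trivial_mod_def by blast
  obtain us where us: "\<forall>(\<alpha>, a, s, b) \<in> set us. a \<in> lists X \<and> b \<in> lists X \<and> s \<in> S
      \<and> lead_word (word a * s * word b) < w"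
    "h = (\<Sum>(\<alpha>, a, s, b) \<leftarrow> us. const \<alpha> * word a * s * word b)"
    using assms(2) unfolding trivial_mod_def by blast
  show ?thesis
    unfolding trivial_mod_def
    by (rule exI[of _ "ts @ us"]) (use ts us in auto)
qed

lemma trivial_mod_const:
  assumes "trivial_mod X S w (h :: ('x::linorder, 'k::field) ncpoly)"
  shows "trivial_mod X S w (const c * h)"
proof -
  obtain ts where ts: "\<forall>(\<alpha>, a, s, b) \<in> set ts. a \<in> lists X \<and> b \<in> lists X \<and> s \<in> S
      \<and> lead_word (word a * s * word b) < w"
    "h = (\<Sum>(\<alpha>, a, s, b) \<leftarrow> ts. const \<alpha> * word a * s * word b)"
    using assms unfolding trivial_mod_def by blast
  have "const c * h = (\<Sum>(\<alpha>, a, s, b) \<leftarrow> map (\<lambda>(\<alpha>, a, s, b). (c * \<alpha>, a, s, b)) ts.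
      const \<alpha> * word a * s * word b)"
    unfolding ts(2) by (induction ts) (auto simp: const_mult distrib_left mult.assoc)
  then show ?thesis
    unfolding trivial_mod_def
    by (intro exI[of _ "map (\<lambda>(\<alpha>, a, s, b). (c * \<alpha>, a, s, b)) ts"]) (use ts in auto)
qed

lemma trivial_mod_uminus:
  assumes "trivial_mod X S w (h :: ('x::linorder, 'k::field) ncpoly)"
  shows "trivial_mod X S w (- h)"
proof -
  have "const (- 1) * h = - h"
    by (simp add: const_uminus)
  then show ?thesis
    using trivial_mod_const[OF assms, of "- 1"] by simp
qed

lemma trivial_mod_sandwich:
  assumes "s \<in> S" "s \<noteq> 0" "a \<in> lists X" "b \<in> lists X" "a @ lead_word s @ b < w"
  shows "trivial_mod X S w (word a * s * word b)"
  unfolding trivial_mod_def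
  by (rule exI[of _ "[(1, a, s, b)]"])
    (use assms in \<open>auto simp: lead_word_sandwich\<close>)

section \<open>Reduction of overlaps\<close>

type_synonym laurent_term = "int \<times> int \<times> (nat \<times> nat) list"

text \<open>\<open>(c, e, u)\<close> stands for \<open>c q\<^sup>e u\<close>; the letters of \<open>u\<close> are renamed by \<open>\<tau>\<close>.\<close>

definition laurent ::
  "'k::field \<Rightarrow> (nat \<times> nat \<Rightarrow> nat \<times> nat) \<Rightarrow> laurent_term list \<Rightarrow> (nat \<times> nat, 'k) ncpoly" where
  "laurent q \<tau> ps = (\<Sum>(c, e, u)\<leftarrow>ps. Poly_Mapping.single (map \<tau> u) (of_int c * q powi e))"

text \<open>Only meaningful for \<open>(i, j) < (m, n)\<close>: the negated lower terms of the relation with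
  leading word \<open>[(m, n), (i, j)]\<close>.\<close>

fun jimbo_rhs :: "nat \<times> nat \<Rightarrow> nat \<times> nat \<Rightarrow> laurent_term list" where
  "jimbo_rhs (m, n) (i, j) =
     (if m = i \<or> n = j then [(1, -2, [(i, j), (m, n)])]
      else if m = j then [(1, 2, [(i, j), (m, n)]), (-1, 1, [(i, n)])]
      else if m < j \<and> j < n
      then [(1, 0, [(i, j), (m, n)]), (-1, 2, [(i, n), (m, j)]), (1, -2, [(i, n), (m, j)])]
      else [(1, 0, [(i, j), (m, n)])])"

text \<open>Only the leftmost descent is rewritten. The words left unchanged are the weakly
  increasing ones, that is, the PBW monomials.\<close>

fun red_word :: "(nat \<times> nat) list \<Rightarrow> laurent_term list" where
  "red_word (y # x # v) =
     (if x < y then map (\<lambda>(c, e, u). (c, e, u @ v)) (jimbo_rhs y x)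
      else map (\<lambda>(c, e, u). (c, e, y # u)) (red_word (x # v)))"
| "red_word v = [(1, 0, v)]"

text \<open>Like terms are merged and vanishing sums dropped on the way, because reduction to zero
  is tested as equality with \<open>[]\<close>.\<close>

fun add_term :: "laurent_term \<Rightarrow> laurent_term list \<Rightarrow> laurent_term list" where
  "add_term t [] = [t]"
| "add_term (c, e, u) ((d, f, v) # ps) =
    (if e = f \<and> u = v then (if c + d = 0 then ps else (c + d, e, u) # ps)
     else (d, f, v) # add_term (c, e, u) ps)"

definition red_step :: "laurent_term list \<Rightarrow> laurent_term list" where
  "red_step ps = foldr (\<lambda>(c, e, u) ps.
     foldr (\<lambda>(d, f, v) ps. add_term (c * d, e + f, v) ps) (red_word u) ps) ps []"

text \<open>Up to sign, the composition at the word yxz, written after the two copies of yxz have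
  cancelled.\<close>

definition overlap ::
  "nat \<times> nat \<Rightarrow> nat \<times> nat \<Rightarrow> nat \<times> nat \<Rightarrow> laurent_term list" where
  "overlap y x z = map (\<lambda>(c, e, u). (c, e, u @ [z])) (jimbo_rhs y x)
     @ map (\<lambda>(c, e, u). (- c, e, y # u)) (jimbo_rhs x z)"

definition "small_vars = [(i, j). i \<leftarrow> [0..<6::nat], j \<leftarrow> [Suc i..<6]]"

text \<open>Proved by evaluation. Coefficients are formal in q, so one computation serves every
  field and every nonzero q. Three rounds, each rewriting the leftmost descent of every term, are
  enough for all triples.\<close>

lemma overlap_confluent:
  "\<forall>y\<in>set small_vars. \<forall>x\<in>set small_vars. \<forall>z\<in>set small_vars.
     z < x \<longrightarrow> x < y \<longrightarrow> (red_step ^^ 3) (overlap y x z) = []"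
  by code_simp

section \<open>Uniform form of the Jimbo relations and their leading words\<close>

definition jimbo_rel :: "'k::field \<Rightarrow> nat \<times> nat \<Rightarrow> nat \<times> nat \<Rightarrow> (nat \<times> nat, 'k) ncpoly" where
  "jimbo_rel q y x = word [y, x] - laurent q id (jimbo_rhs y x)"

text \<open>Two index pairs \<open>(i, j) < (m, n)\<close> have six possible relative positions, and
  the index conditions of the four families of relations cover each of them once.\<close>

lemma jimbo_rels_eq:
  "jimbo_rels N (q :: 'k::field) =
     {jimbo_rel q y x | y x. y \<in> jimbo_vars N \<and> x \<in> jimbo_vars N \<and> x < y}" (is "?L = ?R")
proof
  note defs = jimbo_rel_def laurent_def gen_def word_mult single_eq_const_word power_int_minus
    mult.assoc
  note c = const_uminus const_diff
  show "?L \<subseteq> ?R"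
  proof
    fix f assume "f \<in> ?L"
    then show "f \<in> ?R"
      unfolding jimbo_rels_def Un_iff mem_Collect_eq
      by (elim disjE exE conjE; rename_tac i j m n; rule_tac x = "(m, n)" in exI;
          rule_tac x = "(i, j)" in exI; auto simp: defs c algebra_simps)
  qed
  show "?R \<subseteq> ?L"
  proof
    fix f assume "f \<in> ?R"
    then obtain m n i j where f: "f = jimbo_rel q (m, n) (i, j)"
      and v: "(m, n) \<in> jimbo_vars N" "(i, j) \<in> jimbo_vars N" and lt: "(i, j) < (m, n)"
      by auto
    have "i < j" "m < n" using v by (auto simp: jimbo_vars_def)
    moreover have "i < m \<or> i = m \<and> j < n" using lt by auto
    ultimately have "(i = m \<and> m < j \<and> j < n \<or> i < m \<and> m < j \<and> j = n)
      \<or> (i < m \<and> m < n \<and> n < j \<or> i < j \<and> j < m \<and> m < n)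
      \<or> (i < m \<and> m < j \<and> j < n) \<or> (i < j \<and> j = m \<and> m < n)"
      by arith
    then consider "i = m \<and> m < j \<and> j < n \<or> i < m \<and> m < j \<and> j = n"
      | "i < m \<and> m < n \<and> n < j \<or> i < j \<and> j < m \<and> m < n"
      | "i < m \<and> m < j \<and> j < n" | "i < j \<and> j = m \<and> m < n"
      by blast
    then show "f \<in> ?L"
    proof cases
      case 1
      then have "f = gen (m, n) * gen (i, j) - const (inverse (q^2)) * gen (i, j) * gen (m, n)"
        by (auto simp: f defs c)
      with 1 v show ?thesis unfolding jimbo_rels_def by blast
    next
      case 2
      then have "f = gen (m, n) * gen (i, j) - gen (i, j) * gen (m, n)"
        by (auto simp: f defs c)
      with 2 v show ?thesis unfolding jimbo_rels_def by blast
    next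
      case 3
      then have "f = gen (m, n) * gen (i, j) - gen (i, j) * gen (m, n)
        + const (q^2 - inverse (q^2)) * gen (i, n) * gen (m, j)"
        by (auto simp: f defs c algebra_simps)
      with 3 v show ?thesis unfolding jimbo_rels_def by blast
    next
      case 4
      then have "f = gen (m, n) * gen (i, j) - const (q^2) * gen (i, j) * gen (m, n) + const q * gen (i, n)"
        by (auto simp: f defs c algebra_simps)
      with 4 v show ?thesis unfolding jimbo_rels_def by blast
    qed
  qed
qed

text \<open>Every lower term is a single letter or a two-letter word whose first letter, either
  \<open>x\<close> or \<open>(i, n)\<close> with \<open>i < m\<close>, is smaller than
  \<open>y\<close>.\<close>

lemma jimbo_rhs_less:
  assumes "(c, e, u) \<in> set (jimbo_rhs y x)" "x < y" "fst y < snd y"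
  shows "u < [y, x]"
  using assms by (cases y; cases x) (auto simp: list_less_def Cons_lenlex_iff split: if_splits)

lemma jimbo_rhs_vars:
  assumes "(c, e, u) \<in> set (jimbo_rhs y x)" "x < y" "y \<in> jimbo_vars N" "x \<in> jimbo_vars N"
  shows "u \<in> lists (jimbo_vars N)"
  using assms by (cases y; cases x) (auto simp: jimbo_vars_def split: if_splits)

lemma keys_laurent:
  "w \<in> Poly_Mapping.keys (laurent q \<tau> ps) \<Longrightarrow> \<exists>(c, e, u)\<in>set ps. w = map \<tau> u"
  by (induction ps) (auto simp: laurent_def dest!: set_mp[OF Poly_Mapping.keys_add] split: if_splits)

context
  fixes N :: nat and q :: "'k::field" and x y :: "nat \<times> nat"
  assumes y: "y \<in> jimbo_vars N" and x: "x \<in> jimbo_vars N" and less: "x < y"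
begin

lemma keys_jimbo_rhs:
  assumes "w \<in> Poly_Mapping.keys (laurent q id (jimbo_rhs y x))"
  shows "w < [y, x]" "w \<in> lists (jimbo_vars N)"
proof -
  obtain c e u where u: "(c, e, u) \<in> set (jimbo_rhs y x)" "w = u"
    using keys_laurent[OF assms] by auto
  show "w < [y, x]"
    using jimbo_rhs_less[OF u(1) less] y u(2) by (auto simp: jimbo_vars_def)
  show "w \<in> lists (jimbo_vars N)"
    using jimbo_rhs_vars[OF u(1) less y x] u(2) by simp
qed

lemma jimbo_rel_lookup: "Poly_Mapping.lookup (jimbo_rel q y x) [y, x] = 1"
  using keys_jimbo_rhs(1)[of "[y, x]"]
  by (auto simp: jimbo_rel_def lookup_minus word_def in_keys_iff)

lemma keys_jimbo_rel:
  assumes "w \<in> Poly_Mapping.keys (jimbo_rel q y x)"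
  shows "w \<le> [y, x]" "w \<in> lists (jimbo_vars N)"
proof -
  have "w = [y, x] \<or> w \<in> Poly_Mapping.keys (laurent q id (jimbo_rhs y x))"
    using assms by (auto simp: jimbo_rel_def word_def dest!: set_mp[OF keys_diff])
  then show "w \<le> [y, x]" "w \<in> lists (jimbo_vars N)"
    using keys_jimbo_rhs[of w] x y by auto
qed

lemma lead_word_jimbo_rel: "lead_word (jimbo_rel q y x) = [y, x]"
  unfolding lead_word_def
  by (rule Max_eqI) (use keys_jimbo_rel(1) jimbo_rel_lookup in \<open>auto simp: in_keys_iff\<close>)

lemma monic_jimbo_rel: "monic (jimbo_rel q y x)"
  using jimbo_rel_lookup by (auto simp: monic_def lead_word_jimbo_rel)

end

lemma jimbo_rels_carrier: "jimbo_rels N q \<subseteq> carrier (free_alg (jimbo_vars N))"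
  using keys_jimbo_rel(2) by (fastforce simp: jimbo_rels_eq free_alg_def)

text \<open>A rewriting step that changes the word replaces one factor yx in a context
  \<open>a\<close>, \<open>b\<close>; this is the shape of a multiple \<open>a s b\<close> of a
  relation \<open>s\<close>.\<close>

lemma red_word_cases:
  obtains "red_word u = [(1, 0, u)]"
  | a y x b where "u = a @ [y, x] @ b" "x < y"
      "red_word u = map (\<lambda>(c, e, v). (c, e, a @ v @ b)) (jimbo_rhs y x)"
proof -
  have "red_word u = [(1, 0, u)] \<or> (\<exists>a y x b. u = a @ [y, x] @ b \<and> x < y \<and>
      red_word u = map (\<lambda>(c, e, v). (c, e, a @ v @ b)) (jimbo_rhs y x))"
  proof (induction u rule: red_word.induct)
    case (1 y x v)
    show ?case
    proof (cases "x < y")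
      case True
      then show ?thesis
        by (intro disjI2 exI[of _ "[]"] exI[of _ y] exI[of _ x] exI[of _ v]) auto
    next
      case False
      from 1[OF False] show ?thesis
      proof (elim disjE exE conjE)
        assume "red_word (x # v) = [(1, 0, x # v)]"
        with False show ?thesis by simp
      next
        fix a y' x' b
        assume *: "x # v = a @ [y', x'] @ b" "x' < y'"
          "red_word (x # v) = map (\<lambda>(c, e, v). (c, e, a @ v @ b)) (jimbo_rhs y' x')"
        have "red_word (y # x # v) = map (\<lambda>(c, e, v). (c, e, (y # a) @ v @ b)) (jimbo_rhs y' x')"
          using False by (simp only: red_word.simps(1) *(3) if_False map_map) auto
        moreover have "y # x # v = (y # a) @ [y', x'] @ b"
          using *(1) by simp
        ultimately show ?thesis
          using *(2) by blast
      qed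
    qed
  qed simp_all
  with that show ?thesis by blast
qed

text \<open>The case distinction in \<open>jimbo_rhs\<close> uses only equalities and strict
  inequalities between indices, and a strictly monotone relabelling preserves both.\<close>

lemma jimbo_rhs_map:
  assumes "strict_mono \<sigma>"
  shows "jimbo_rhs (map_prod \<sigma> \<sigma> y) (map_prod \<sigma> \<sigma> x) =
    map (\<lambda>(c, e, u). (c, e, map (map_prod \<sigma> \<sigma>) u)) (jimbo_rhs y x)"
  using assms by (cases y; cases x) (simp add: strict_mono_eq strict_mono_less)

lemma map_prod_less_iff:
  assumes "strict_mono \<sigma>"
  shows "map_prod \<sigma> \<sigma> x < map_prod \<sigma> \<sigma> y \<longleftrightarrow> x < (y :: nat \<times> nat)"
  using assms by (cases y; cases x) (auto simp: strict_mono_less strict_mono_less_eq)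

section \<open>Evaluation of formal Laurent combinations in the free algebra\<close>

lemma laurent_Nil: "laurent q \<tau> [] = 0"
  by (simp add: laurent_def)

lemma laurent_Cons: "laurent q \<tau> ((c, e, u) # ps) =
    Poly_Mapping.single (map \<tau> u) (of_int c * q powi e) + laurent q \<tau> ps"
  by (simp add: laurent_def)

lemma laurent_append: "laurent q \<tau> (ps @ ps') = laurent q \<tau> ps + laurent q \<tau> ps'"
  by (simp add: laurent_def)

lemma laurent_map: "laurent q (\<tau> \<circ> \<rho>) ps = laurent q \<tau> (map (\<lambda>(c, e, u). (c, e, map \<rho> u)) ps)"
  by (induction ps) (auto simp: laurent_Nil laurent_Cons comp_def)

lemma laurent_sandwich:
  "laurent q \<tau> (map (\<lambda>(c, e, v). (c, e, a @ v @ b)) ps) =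
     word (map \<tau> a) * laurent q \<tau> ps * word (map \<tau> b)"
  by (induction ps) (auto simp: laurent_Nil laurent_Cons distrib_left distrib_right word_mult_single)

lemma laurent_add_term:
  "laurent q \<tau> (add_term (c, e, u) ps) =
     Poly_Mapping.single (map \<tau> u) (of_int c * q powi e) + laurent q \<tau> ps"
proof (induction ps)
  case (Cons p ps)
  obtain d f v where "p = (d, f, v)" by (cases p)
  moreover have "of_int d * q powi e = - (of_int c * q powi e)" if "c + d = 0"
    using that by (metis add_eq_0_iff mult_minus_left of_int_minus)
  ultimately show ?case
    using Cons by (auto simp: laurent_Cons single_uminus single_add distrib_right add.assoc)
qed (simp add: laurent_Nil laurent_Cons)

lemma set_add_term:
  "(c', e', u') \<in> set (add_term (c, e, u) ps) \<Longrightarrow> u' = u \<or> (\<exists>d f. (d, f, u') \<in> set ps)"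
proof (induction ps)
  case (Cons p ps)
  then show ?case by (cases p) (auto split: if_splits)
qed simp


lemma laurent_uminus: "laurent q \<tau> (map (\<lambda>(d, f, v). (- d, f, v)) ps) = - laurent q \<tau> ps"
  by (induction ps) (auto simp: laurent_Nil laurent_Cons single_uminus)

lemma laurent_foldr_add_term:
  assumes "q \<noteq> 0"
  shows "laurent q \<tau> (foldr (\<lambda>(d, f, v) ps. add_term (c * d, e + f, v) ps) rs ps) =
    const (of_int c * q powi e) * laurent q \<tau> rs + laurent q \<tau> ps"
  using assms
  by (induction rs) (auto simp: laurent_Nil laurent_Cons laurent_add_term distrib_left const_mult_single
      power_int_add mult_ac add.assoc)

lemma set_foldr_add_term:
  "(c', e', u) \<in> set (foldr (\<lambda>(d, f, v) ps. add_term (c * d, e + f, v) ps) rs ps) \<Longrightarrow>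
    (\<exists>d f. (d, f, u) \<in> set rs) \<or> (\<exists>d f. (d, f, u) \<in> set ps)"
proof (induction rs arbitrary: c' e')
  case (Cons r rs)
  obtain d f v where r: "r = (d, f, v)" by (cases r)
  from Cons.prems consider "u = v"
    | d' f' where "(d', f', u) \<in> set (foldr (\<lambda>(d, f, v) ps. add_term (c * d, e + f, v) ps) rs ps)"
    by (auto simp: r dest!: set_add_term)
  then show ?case
  proof cases
    case 2
    from Cons.IH[OF this] show ?thesis by auto
  qed (auto simp: r)
qed auto

lemma red_step_Cons:
  "red_step ((c, e, u) # ps) =
    foldr (\<lambda>(d, f, v) ps. add_term (c * d, e + f, v) ps) (red_word u) (red_step ps)"
  by (simp add: red_step_def)

section \<open>Soundness of the formal reduction after relabelling the indices\<close>

context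
  fixes N :: nat and q :: "'k::field" and \<sigma> :: "nat \<Rightarrow> nat" and \<tau> and w :: "(nat \<times> nat) list"
  assumes q: "q \<noteq> 0" and \<sigma>: "strict_mono \<sigma>" and \<tau>_def: "\<tau> = map_prod \<sigma> \<sigma>"
begin

abbreviation "below u \<equiv> map \<tau> u \<in> lists (jimbo_vars N) \<and> map \<tau> u < w"

text \<open>Rewriting a factor subtracts a multiple \<open>a s b\<close> of a relation whose leading
  word is the rewritten word itself, hence below \<open>w\<close>. The new words are smaller still,
  so the bound survives further steps.\<close>

lemma red_word_sound:
  assumes "below u"
  shows "trivial_mod (jimbo_vars N) (jimbo_rels N q) w (word (map \<tau> u) - laurent q \<tau> (red_word u))"
    and "(c, e, v) \<in> set (red_word u) \<Longrightarrow> below v"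
proof -
  have "trivial_mod (jimbo_vars N) (jimbo_rels N q) w (word (map \<tau> u) - laurent q \<tau> (red_word u))
     \<and> (\<forall>(c, e, v) \<in> set (red_word u). below v)"
  proof (cases rule: red_word_cases[of u])
    case 1
    with assms show ?thesis
      by (auto simp: laurent_Cons laurent_Nil word_def trivial_mod_0)
  next
    case (2 a y x b)
    let ?y = "\<tau> y" and ?x = "\<tau> x"
    have rhs: "jimbo_rhs ?y ?x = map (\<lambda>(c, e, u). (c, e, map \<tau> u)) (jimbo_rhs y x)"
      unfolding \<tau>_def by (rule jimbo_rhs_map[OF \<sigma>])
    have less: "?x < ?y"
      using 2(2) map_prod_less_iff[OF \<sigma>] by (simp add: \<tau>_def)
    have v: "?y \<in> jimbo_vars N" "?x \<in> jimbo_vars N" "map \<tau> a \<in> lists (jimbo_vars N)"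
      "map \<tau> b \<in> lists (jimbo_vars N)" and below: "map \<tau> a @ [?y, ?x] @ map \<tau> b < w"
      using assms 2(1) by auto
    have "word (map \<tau> u) - laurent q \<tau> (red_word u) = word (map \<tau> a) * jimbo_rel q ?y ?x * word (map \<tau> b)"
    proof -
      have "laurent q id (jimbo_rhs ?y ?x) = laurent q \<tau> (jimbo_rhs y x)"
        using laurent_map[of q id \<tau> "jimbo_rhs y x"] by (simp add: rhs)
      then show ?thesis
        unfolding 2(3) laurent_sandwich
        by (simp add: 2(1) jimbo_rel_def right_diff_distrib left_diff_distrib word_mult)
    qed
    moreover have "jimbo_rel q ?y ?x \<in> jimbo_rels N q"
      unfolding jimbo_rels_eq using v(1,2) less by blast
    then have "trivial_mod (jimbo_vars N) (jimbo_rels N q) w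
        (word (map \<tau> a) * jimbo_rel q ?y ?x * word (map \<tau> b))"
      using v below less monic_jimbo_rel[OF v(1,2) less, of q]
      by (intro trivial_mod_sandwich) (auto simp: monic_def lead_word_jimbo_rel)
    moreover have "below v" if v': "(c, e, v) \<in> set (red_word u)" for c e v
    proof -
      obtain t where t: "(c, e, t) \<in> set (jimbo_rhs y x)" "v = a @ t @ b"
        using v' by (auto simp: 2(3))
      then have t': "(c, e, map \<tau> t) \<in> set (jimbo_rhs ?y ?x)"
        by (force simp: rhs)
      have "map \<tau> t < [?y, ?x]"
        using jimbo_rhs_less[OF t' less] v(1) by (auto simp: jimbo_vars_def)
      from append_strict_mono[OF this, of "map \<tau> a" "map \<tau> b"] below
      show ?thesis
        using jimbo_rhs_vars[OF t' less v(1,2)] v(3,4) by (auto simp: t(2))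
    qed
    ultimately show ?thesis by auto
  qed
  then show "trivial_mod (jimbo_vars N) (jimbo_rels N q) w (word (map \<tau> u) - laurent q \<tau> (red_word u))"
    and "(c, e, v) \<in> set (red_word u) \<Longrightarrow> below v" by auto
qed

lemma red_step_sound:
  assumes "\<forall>(c, e, u)\<in>set ps. below u"
  shows "trivial_mod (jimbo_vars N) (jimbo_rels N q) w (laurent q \<tau> ps - laurent q \<tau> (red_step ps))"
    and "\<forall>(c, e, u)\<in>set (red_step ps). below u"
proof -
  have "trivial_mod (jimbo_vars N) (jimbo_rels N q) w (laurent q \<tau> ps - laurent q \<tau> (red_step ps))
    \<and> (\<forall>(c, e, u)\<in>set (red_step ps). below u)"
    using assms
  proof (induction ps)
    case Nil
    then show ?case by (simp add: red_step_def laurent_Nil trivial_mod_0)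
  next
    case (Cons p ps)
    obtain c e u where p: "p = (c, e, u)" by (cases p)
    with Cons.prems have u: "below u" and ps: "\<forall>(c, e, u)\<in>set ps. below u" by auto
    have "laurent q \<tau> (p # ps) - laurent q \<tau> (red_step (p # ps)) =
      const (of_int c * q powi e) * (word (map \<tau> u) - laurent q \<tau> (red_word u))
        + (laurent q \<tau> ps - laurent q \<tau> (red_step ps))"
      using q by (simp add: p laurent_Cons red_step_Cons laurent_foldr_add_term right_diff_distrib
          single_eq_const_word)
    moreover have "below v" if "(d, f, v) \<in> set (red_step (p # ps))" for d f v
    proof -
      have "(\<exists>d f. (d, f, v) \<in> set (red_word u)) \<or> (\<exists>d f. (d, f, v) \<in> set (red_step ps))"
        using that unfolding p red_step_Cons by (rule set_foldr_add_term)
      then show ?thesis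
        using red_word_sound(2)[OF u] Cons.IH[OF ps] by blast
    qed
    ultimately show ?case
      using Cons.IH[OF ps] red_word_sound(1)[OF u] by (auto intro: trivial_mod_add trivial_mod_const)
  qed
  then show "trivial_mod (jimbo_vars N) (jimbo_rels N q) w (laurent q \<tau> ps - laurent q \<tau> (red_step ps))"
    and "\<forall>(c, e, u)\<in>set (red_step ps). below u" by auto
qed

text \<open>The differences between successive reductions are trivial, and their sum telescopes to
  the initial polynomial.\<close>

lemma trivial_mod_if_red_steps_Nil:
  assumes "\<forall>(c, e, u)\<in>set ps. below u" "(red_step ^^ n) ps = []"
  shows "trivial_mod (jimbo_vars N) (jimbo_rels N q) w (laurent q \<tau> ps)"
  using assms
proof (induction n arbitrary: ps)
  case 0
  then show ?case by (simp add: laurent_Nil trivial_mod_0)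
next
  case (Suc n)
  have "trivial_mod (jimbo_vars N) (jimbo_rels N q) w (laurent q \<tau> (red_step ps))"
    using Suc.prems red_step_sound(2) by (intro Suc.IH) (auto simp: funpow_swap1)
  then show ?case
    using trivial_mod_add[OF red_step_sound(1)[OF Suc.prems(1)]] by fastforce
qed

end

text \<open>Adding to \<open>E\<close> a tail \<open>{M..}\<close> above all its elements gives an
  infinite set whose increasing enumeration is total and lists \<open>E\<close> first.\<close>

lemma ex_strict_mono_cover:
  fixes E :: "nat set"
  assumes "finite E" "card E \<le> k"
  obtains \<sigma> :: "nat \<Rightarrow> nat" where "strict_mono \<sigma>" "E \<subseteq> \<sigma> ` {..<k}"
proof -
  obtain M where M: "\<forall>e\<in>E. e < M"
    using finite_nat_set_iff_bounded assms(1) by auto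
  define S where "S = E \<union> {M..}"
  have inf: "infinite S"
    by (simp add: S_def infinite_Ici)
  have "e \<in> Infinite_Set.enumerate S ` {..<k}" if e: "e \<in> E" for e
  proof -
    obtain n where n: "e = Infinite_Set.enumerate S n"
      using e range_enumerate[OF inf] by (auto simp: S_def)
    \<comment> \<open>Since \<open>e < M\<close>, all elements of \<open>S\<close> up to
      \<open>e\<close> belong to \<open>E\<close>. There are \<open>n + 1\<close> of them, so
      \<open>n < card E\<close>.\<close>
    have "Infinite_Set.enumerate S ` {..n} \<subseteq> E"
    proof
      fix s assume "s \<in> Infinite_Set.enumerate S ` {..n}"
      then have "s \<in> S" "s \<le> e"
        using enumerate_in_set[OF inf] strict_mono_enumerate[OF inf] by (auto simp: n strict_mono_less_eq)
      then show "s \<in> E" using M e by (auto simp: S_def)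
    qed
    then have "card (Infinite_Set.enumerate S ` {..n}) \<le> card E"
      by (rule card_mono[OF assms(1)])
    moreover have "card (Infinite_Set.enumerate S ` {..n}) = Suc n"
      using strict_mono_imp_inj_on[OF strict_mono_enumerate[OF inf]] by (simp add: card_image inj_on_subset)
    ultimately show ?thesis using n assms(2) by auto
  qed
  with strict_mono_enumerate[OF inf] show ?thesis by (intro that) auto
qed

section \<open>Compositions of the Jimbo relations\<close>

lemma overlap_trivial:
  fixes q :: "'k::field"
  assumes q: "q \<noteq> 0" and v: "y \<in> jimbo_vars N" "x \<in> jimbo_vars N" "z \<in> jimbo_vars N"
    and less: "z < x" "x < y"
  shows "trivial_mod (jimbo_vars N) (jimbo_rels N q) [y, x, z]
    (jimbo_rel q y x * word [z] - word [y] * jimbo_rel q x z)"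
proof -
  \<comment> \<open>Only an upper bound, since the indices of the three letters may
    coincide.\<close>
  have "card {fst y, snd y, fst x, snd x, fst z, snd z} \<le> 6"
    using card_length[of "[fst y, snd y, fst x, snd x, fst z, snd z]"] by simp
  then obtain \<sigma> :: "nat \<Rightarrow> nat" where \<sigma>: "strict_mono \<sigma>"
    and cover: "{fst y, snd y, fst x, snd x, fst z, snd z} \<subseteq> \<sigma> ` {..<6}"
    by (rule ex_strict_mono_cover[rotated]) auto
  define \<tau> where "\<tau> = map_prod \<sigma> \<sigma>"
  have pre: "\<exists>p'\<in>set small_vars. p = \<tau> p'"
    if p: "p \<in> jimbo_vars N" "fst p \<in> \<sigma> ` {..<6}" "snd p \<in> \<sigma> ` {..<6}" for p
  proof -
    obtain a b where ab: "p = (\<sigma> a, \<sigma> b)" "a < 6" "b < 6"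
      using p(2,3) by (cases p) auto
    then have "a < b"
      using p(1) strict_mono_less[OF \<sigma>] by (auto simp: jimbo_vars_def)
    with ab have "(a, b) \<in> set small_vars" by (auto simp: small_vars_def image_iff)
    with ab show ?thesis by (force simp: \<tau>_def)
  qed
  \<comment> \<open>The three letters are pulled back to letters with indices below 6, where the
    finite computation applies.\<close>
  obtain y' x' z' where pre: "y' \<in> set small_vars" "x' \<in> set small_vars" "z' \<in> set small_vars"
    "y = \<tau> y'" "x = \<tau> x'" "z = \<tau> z'"
    using pre[of y] pre[of x] pre[of z] v cover by auto
  have less': "z' < x'" "x' < y'"
    using less map_prod_less_iff[OF \<sigma>] by (auto simp: pre \<tau>_def)
  have rhs: "jimbo_rhs (\<tau> a) (\<tau> b) = map (\<lambda>(c, e, u). (c, e, map \<tau> u)) (jimbo_rhs a b)" for a b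
    unfolding \<tau>_def by (rule jimbo_rhs_map[OF \<sigma>])
  have lrhs: "laurent q id (jimbo_rhs (\<tau> a) (\<tau> b)) = laurent q \<tau> (jimbo_rhs a b)" for a b
    using laurent_map[of q id \<tau> "jimbo_rhs a b"] by (simp add: rhs)
  have "below N \<tau> [y, x, z] u" if "(c, e, u) \<in> set (overlap y' x' z')" for c e u
    using that unfolding overlap_def set_append Un_iff
  proof
    assume "(c, e, u) \<in> set (map (\<lambda>(c, e, u). (c, e, u @ [z'])) (jimbo_rhs y' x'))"
    then obtain t where t: "(c, e, map \<tau> t) \<in> set (jimbo_rhs y x)" "u = t @ [z']"
      by (force simp: pre rhs)
    have "map \<tau> t < [y, x]"
      using jimbo_rhs_less[OF t(1) less(2)] v(1) by (auto simp: jimbo_vars_def)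
    from append_strict_mono[OF this, of "[]" "[z]"] show ?thesis
      using jimbo_rhs_vars[OF t(1) less(2) v(1,2)] v(3) by (simp add: t(2) pre)
  next
    assume "(c, e, u) \<in> set (map (\<lambda>(c, e, u). (- c, e, y' # u)) (jimbo_rhs x' z'))"
    then obtain t where t: "(- c, e, map \<tau> t) \<in> set (jimbo_rhs x z)" "u = y' # t"
      by (force simp: pre rhs)
    have "map \<tau> t < [x, z]"
      using jimbo_rhs_less[OF t(1) less(1)] v(2) by (auto simp: jimbo_vars_def)
    from append_strict_mono[OF this, of "[y]" "[]"] show ?thesis
      using jimbo_rhs_vars[OF t(1) less(1) v(2,3)] v(1) by (simp add: t(2) pre)
  qed
  moreover have "(red_step ^^ 3) (overlap y' x' z') = []"
    using overlap_confluent pre less' by blast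
  ultimately have "trivial_mod (jimbo_vars N) (jimbo_rels N q) [y, x, z] (laurent q \<tau> (overlap y' x' z'))"
    by (intro trivial_mod_if_red_steps_Nil[OF q \<sigma> \<tau>_def, of _ _ _ 3]) auto
  moreover have "laurent q \<tau> (overlap y' x' z') =
      laurent q \<tau> (jimbo_rhs y' x') * word [z] - word [y] * laurent q \<tau> (jimbo_rhs x' z')"
  proof -
    have "map (\<lambda>(c, e, u). (- c, e, y' # u)) (jimbo_rhs x' z') =
      map (\<lambda>(c, e, u). (- c, e, u)) (map (\<lambda>(c, e, v). (c, e, [y'] @ v @ [])) (jimbo_rhs x' z'))"
      by auto
    moreover have "laurent q \<tau> (map (\<lambda>(c, e, u). (c, e, u @ [z'])) (jimbo_rhs y' x')) =
      laurent q \<tau> (jimbo_rhs y' x') * word [z]"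
      using laurent_sandwich[of q \<tau> "[]" "[z']" "jimbo_rhs y' x'"] by (simp add: pre word_Nil)
    ultimately show ?thesis
      by (simp only: overlap_def laurent_append laurent_uminus laurent_sandwich) (simp add: pre word_Nil)
  qed
  moreover have "jimbo_rel q y x * word [z] - word [y] * jimbo_rel q x z =
      - (laurent q \<tau> (jimbo_rhs y' x') * word [z] - word [y] * laurent q \<tau> (jimbo_rhs x' z'))"
    by (simp add: jimbo_rel_def pre lrhs left_diff_distrib right_diff_distrib word_mult)
  ultimately show ?thesis
    by (metis trivial_mod_uminus)
qed

text \<open>All leading words have length two and each determines its relation. So two relations
  either coincide, with composition 0, or overlap in exactly one letter.\<close>

theorem groebner_shirshov_basis_jimbo_rels:
  fixes q :: "'k::field"
  assumes "q \<noteq> 0"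
  shows "groebner_shirshov_basis (jimbo_vars N) (jimbo_rels N q)"
  unfolding groebner_shirshov_basis_def
proof (intro conjI ballI allI impI)
  show "jimbo_rels N q \<subseteq> carrier (free_alg (jimbo_vars N))"
    by (rule jimbo_rels_carrier)
  show "monic s" if "s \<in> jimbo_rels N q" for s
    using that monic_jimbo_rel unfolding jimbo_rels_eq by blast
  fix f g w h
  assume "f \<in> jimbo_rels N q" "g \<in> jimbo_rels N q" and comp: "composition (jimbo_vars N) f g w h"
  then obtain y x y' x' where f: "f = jimbo_rel q y x" "y \<in> jimbo_vars N" "x \<in> jimbo_vars N" "x < y"
    and g: "g = jimbo_rel q y' x'" "y' \<in> jimbo_vars N" "x' \<in> jimbo_vars N" "x' < y'"
    by (auto simp: jimbo_rels_eq)
  have lead: "lead_word f = [y, x]" "lead_word g = [y', x']"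
    using lead_word_jimbo_rel[OF f(2-4)] lead_word_jimbo_rel[OF g(2-4)] by (simp_all add: f(1) g(1))
  from comp show "trivial_mod (jimbo_vars N) (jimbo_rels N q) w h"
  proof cases
    case (intersection a b)
    \<comment> \<open>The length condition also admits the complete overlap, in which both leading
      words equal \<open>w\<close>.\<close>
    then consider "a = []" "b = []" | "a = [y]" "b = [x']" "y' = x"
      by (auto simp: lead append_eq_Cons_conv Cons_eq_append_conv)
    then show ?thesis
    proof cases
      case 1
      then have "f = g" using intersection(4,5) lead by (simp add: f(1) g(1))
      then have "h = 0" using 1 intersection(1) by (simp add: word_Nil)
      then show ?thesis by (simp add: trivial_mod_0)
    next
      case 2
      have "w = [y, x, x']" "h = jimbo_rel q y x * word [x'] - word [y] * jimbo_rel q x x'"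
        using 2 intersection(1,4) lead(1) by (simp_all add: f(1) g(1))
      with overlap_trivial[OF assms f(2,3) g(3) _ f(4)] g(4) 2(3) show ?thesis
        by simp
    qed
  next
    case (inclusion a b)
    then have "a = [] \<and> b = []"
      by (auto simp: lead append_eq_Cons_conv Cons_eq_append_conv)
    then have "f = g" using inclusion(4,5) lead by (simp add: f(1) g(1))
    then have "h = 0" using \<open>a = [] \<and> b = []\<close> inclusion(1) by (simp add: word_Nil)
    then show ?thesis by (simp add: trivial_mod_0)
  qed
qed

section \<open>The Jimbo relations from the Serre relations\<close>

locale two_sided_ideal =
  fixes I :: "'a::ring_1 set"
  assumes zero_mem: "0 \<in> I"
    and add_mem: "x \<in> I \<Longrightarrow> y \<in> I \<Longrightarrow> x + y \<in> I"
    and mult_left_mem: "x \<in> I \<Longrightarrow> c * x \<in> I"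
    and mult_right_mem: "x \<in> I \<Longrightarrow> x * c \<in> I"
begin

lemma uminus_mem: "x \<in> I \<Longrightarrow> - x \<in> I"
  using mult_left_mem[of x "- 1"] by simp

lemma diff_mem: "x \<in> I \<Longrightarrow> y \<in> I \<Longrightarrow> x - y \<in> I"
  using add_mem[of x "- y"] uminus_mem by simp

lemmas mem_intros = zero_mem add_mem diff_mem uminus_mem mult_left_mem mult_right_mem

end

text \<open>\<open>Q\<close>, \<open>P\<close> and \<open>R\<close> stand for the constants \<open>q\<close>, \<open>q\<^sup>-\<^sup>1\<close> and \<open>(q\<^sup>2 + q\<^sup>-\<^sup>2)\<^sup>-\<^sup>1\<close>.\<close>

locale q_ideal = two_sided_ideal I for I :: "'a::ring_1 set" +
  fixes Q P R :: 'a
  assumes Q_central: "x * Q = Q * x"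
    and P_central: "x * P = P * x"
    and QP: "Q * P = 1"
    and R: "R * (Q * Q + P * P) = 1"
begin

text \<open>Oriented so that constants move to the left of everything else. The guards exclude the
  constants themselves, between which the exchange would never end.\<close>

lemma Q_central': "NO_MATCH Q x \<Longrightarrow> NO_MATCH P x \<Longrightarrow> x * Q = Q * x"
    "NO_MATCH Q x \<Longrightarrow> NO_MATCH P x \<Longrightarrow> x * (Q * y) = Q * (x * y)"
  by (metis Q_central mult.assoc)+

lemma P_central': "NO_MATCH Q x \<Longrightarrow> NO_MATCH P x \<Longrightarrow> x * P = P * x"
    "NO_MATCH Q x \<Longrightarrow> NO_MATCH P x \<Longrightarrow> x * (P * y) = P * (x * y)"
  by (metis P_central mult.assoc)+

lemma PQ: "P * Q = 1" "P * (Q * x) = x" "Q * (P * x) = x"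
  using QP P_central[of Q] by (simp_all flip: mult.assoc)

lemmas q_simps = Q_central' P_central' QP PQ mult.assoc distrib_left distrib_right
  left_diff_distrib right_diff_distrib

definition br :: "'a \<Rightarrow> 'a \<Rightarrow> 'a" where
  "br x y = Q * x * y - P * y * x"

definition comm :: "'a \<Rightarrow> 'a \<Rightarrow> bool" where
  "comm x y \<longleftrightarrow> x * y - y * x \<in> I"

text \<open>Not symmetric: when applied to two Jimbo generators, the larger letter comes first, as
  in the leading word of the relation.\<close>

definition qcomm :: "'a \<Rightarrow> 'a \<Rightarrow> bool" where
  "qcomm x y \<longleftrightarrow> x * y - P * P * y * x \<in> I"

lemma comm_sym: "comm x y \<Longrightarrow> comm y x"
  unfolding comm_def by (metis minus_diff_eq uminus_mem)

text \<open>Leibniz rule: the commutator with \<open>z\<close> is a derivation.\<close>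

lemma comm_br:
  assumes "comm z x" "comm z y"
  shows "comm z (br x y)"
proof -
  have "z * br x y - br x y * z =
      Q * ((z * x - x * z) * y + x * (z * y - y * z)) - P * ((z * y - y * z) * x + y * (z * x - x * z))"
    by (simp add: br_def q_simps)
  also have "\<dots> \<in> I"
    using assms unfolding comm_def by (blast intro: mem_intros)
  finally show ?thesis
    unfolding comm_def .
qed

text \<open>Twisted Leibniz rule: \<open>z\<close> picks up the factor q^-2 only when passing the
  argument with which it q-commutes. The four variants cover the two sides for \<open>z\<close> and
  the two positions of that argument.\<close>

lemma qcomm_br_right1:
  assumes "qcomm z x" "comm z y"
  shows "qcomm z (br x y)"
proof -
  have "z * br x y - P * P * br x y * z =
      Q * ((z * x - P * P * x * z) * y + P * P * x * (z * y - y * z))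
        - P * ((z * y - y * z) * x + y * (z * x - P * P * x * z))"
    by (simp add: br_def q_simps)
  also have "\<dots> \<in> I"
    using assms unfolding comm_def qcomm_def by (blast intro: mem_intros)
  finally show ?thesis
    unfolding qcomm_def .
qed

lemma qcomm_br_right2:
  assumes "comm z x" "qcomm z y"
  shows "qcomm z (br x y)"
proof -
  have "z * br x y - P * P * br x y * z =
      Q * ((z * x - x * z) * y + x * (z * y - P * P * y * z))
        - P * ((z * y - P * P * y * z) * x + P * P * y * (z * x - x * z))"
    by (simp add: br_def q_simps)
  also have "\<dots> \<in> I"
    using assms unfolding comm_def qcomm_def by (blast intro: mem_intros)
  finally show ?thesis
    unfolding qcomm_def .
qed

lemma qcomm_br_left1:
  assumes "qcomm x z" "comm y z"
  shows "qcomm (br x y) z"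
proof -
  have "br x y * z - P * P * z * br x y =
      Q * (x * (y * z - z * y) + (x * z - P * P * z * x) * y)
        - P * (y * (x * z - P * P * z * x) + P * P * (y * z - z * y) * x)"
    by (simp add: br_def q_simps)
  also have "\<dots> \<in> I"
    using assms unfolding comm_def qcomm_def by (blast intro: mem_intros)
  finally show ?thesis
    unfolding qcomm_def .
qed

lemma qcomm_br_left2:
  assumes "comm x z" "qcomm y z"
  shows "qcomm (br x y) z"
proof -
  have "br x y * z - P * P * z * br x y =
      Q * (x * (y * z - P * P * z * y) + P * P * (x * z - z * x) * y)
        - P * (y * (x * z - z * x) + (y * z - P * P * z * y) * x)"
    by (simp add: br_def q_simps)
  also have "\<dots> \<in> I"
    using assms unfolding comm_def qcomm_def by (blast intro: mem_intros)
  finally show ?thesis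
    unfolding qcomm_def .
qed

lemma qcomm_cong_left:
  assumes "x - x' \<in> I" "qcomm x' z"
  shows "qcomm x z"
proof -
  have "x * z - P * P * z * x = (x' * z - P * P * z * x') + ((x - x') * z - P * P * z * (x - x'))"
    by (simp add: q_simps)
  also have "\<dots> \<in> I"
    using assms unfolding qcomm_def by (blast intro: mem_intros)
  finally show ?thesis
    unfolding qcomm_def .
qed

lemma qcomm_cong_right:
  assumes "x - x' \<in> I" "qcomm z x'"
  shows "qcomm z x"
proof -
  have "z * x - P * P * x * z = (z * x' - P * P * x' * z) + (z * (x - x') - P * P * (x - x') * z)"
    by (simp add: q_simps)
  also have "\<dots> \<in> I"
    using assms unfolding qcomm_def by (blast intro: mem_intros)
  finally show ?thesis
    unfolding qcomm_def .
qed

text \<open>The terms in xyz and zyx are the same for both bracketings, with coefficients q^2 and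
  q^-2. What remains contains the factor xz - zx.\<close>

lemma br_assoc:
  assumes "comm x z"
  shows "br (br x y) z - br x (br y z) \<in> I"
proof -
  have "br (br x y) z - br x (br y z) = (x * z - z * x) * y - y * (x * z - z * x)"
    by (simp add: br_def q_simps)
  also have "\<dots> \<in> I"
    using assms unfolding comm_def by (blast intro: mem_intros)
  finally show ?thesis
    .
qed

lemma br_cong_left: "x - x' \<in> I \<Longrightarrow> br x y - br x' y \<in> I"
proof -
  assume "x - x' \<in> I"
  moreover have "br x y - br x' y = Q * (x - x') * y - P * y * (x - x')"
    by (simp add: br_def q_simps)
  ultimately show ?thesis by (metis mem_intros(3,5,6))
qed

text \<open>For \<open>i < m < j < n\<close> this is applied to \<open>a = x\<^sub>i\<^sub>m\<close>, \<open>b = x\<^sub>m\<^sub>j\<close>, \<open>c = x\<^sub>j\<^sub>n\<close>, \<open>d = x\<^sub>i\<^sub>j\<close>, \<open>f = x\<^sub>m\<^sub>n\<close>,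
  \<open>h = x\<^sub>i\<^sub>n\<close>. Expanding \<open>f\<close> or \<open>d\<close> in \<open>df\<close> gives two expressions for \<open>df - fd\<close>, and their difference
  is \<open>(q\<^sup>2 + q\<^sup>-\<^sup>2) (bh - hb)\<close>.\<close>

lemma comm_and_exchange:
  assumes d: "d - br a b \<in> I" and f: "f - br b c \<in> I" and h: "h - br d c \<in> I" "h - br a f \<in> I"
    and bd: "qcomm b d" and fb: "qcomm f b"
  shows "comm b h" "f * d - d * f + (Q * Q - P * P) * h * b \<in> I"
proof -
  have 1: "d * f - f * d - Q * Q * b * h + P * P * h * b =
      d * (f - br b c) - (f - br b c) * d - Q * Q * Q * (b * d - P * P * d * b) * c
      + P * c * (b * d - P * P * d * b) - Q * Q * b * (h - br d c) + P * P * (h - br d c) * b"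
    by (simp add: br_def q_simps)
  have 2: "d * f - f * d - Q * Q * h * b + P * P * b * h =
      (d - br a b) * f - f * (d - br a b) - Q * Q * Q * a * (f * b - P * P * b * f)
      + P * (f * b - P * P * b * f) * a - Q * Q * (h - br a f) * b + P * P * b * (h - br a f)"
    by (simp add: br_def q_simps)
  have 1: "d * f - f * d - Q * Q * b * h + P * P * h * b \<in> I"
    unfolding 1 using f h(1) bd unfolding qcomm_def by (blast intro: mem_intros)
  have 2: "d * f - f * d - Q * Q * h * b + P * P * b * h \<in> I"
    unfolding 2 using d h(2) fb unfolding qcomm_def by (blast intro: mem_intros)
  have "b * h - h * b = R * (Q * Q + P * P) * (b * h - h * b)"
    by (simp add: R)
  also have "\<dots> = R * ((d * f - f * d - Q * Q * h * b + P * P * b * h)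
      - (d * f - f * d - Q * Q * b * h + P * P * h * b))"
    by (simp add: q_simps)
  also have "\<dots> \<in> I"
    using 1 2 by (blast intro: mem_intros)
  finally show bh: "comm b h"
    unfolding comm_def .
  have "f * d - d * f + (Q * Q - P * P) * h * b =
      - (d * f - f * d - Q * Q * b * h + P * P * h * b) - Q * Q * (b * h - h * b)"
    by (simp add: q_simps)
  also have "\<dots> \<in> I"
    using 1 bh unfolding comm_def by (blast intro: mem_intros)
  finally show "f * d - d * f + (Q * Q - P * P) * h * b \<in> I" .
qed

definition serre :: "'a \<Rightarrow> 'a \<Rightarrow> bool" where
  "serre x y \<longleftrightarrow> x * x * y - (Q * Q + P * P) * x * y * x + y * x * x \<in> I"

text \<open>The Serre element and the q-commutation defect of the bracket with \<open>x\<close>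
  differ only by the invertible factor -q.\<close>

lemma qcomm_br_left_iff_serre: "qcomm (br x y) x \<longleftrightarrow> serre x y"
proof -
  have "br x y * x - P * P * x * br x y = - P * (x * x * y - (Q * Q + P * P) * x * y * x + y * x * x)"
    "x * x * y - (Q * Q + P * P) * x * y * x + y * x * x = - Q * (br x y * x - P * P * x * br x y)"
    by (simp_all add: br_def q_simps)
  then show ?thesis
    unfolding qcomm_def serre_def by (metis mult_left_mem)
qed

lemma qcomm_br_right_iff_serre: "qcomm y (br x y) \<longleftrightarrow> serre y x"
proof -
  have "y * br x y - P * P * br x y * y = - P * (y * y * x - (Q * Q + P * P) * y * x * y + x * y * y)"
    "y * y * x - (Q * Q + P * P) * y * x * y + x * y * y = - Q * (y * br x y - P * P * br x y * y)"
    by (simp_all add: br_def q_simps)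
  then show ?thesis
    unfolding qcomm_def serre_def by (metis mult_left_mem)
qed

end

section \<open>Relations between the iterated brackets of the simple generators\<close>

locale uq_generators = q_ideal I Q P R for I :: "'a::ring_1 set" and Q P R +
  fixes e :: "nat \<Rightarrow> nat \<Rightarrow> 'a" and N :: nat
  assumes e_rec: "i + 1 < j \<Longrightarrow> e i j = br (e i (j - 1)) (e (j - 1) j)"
    and far: "1 \<le> i \<Longrightarrow> i + 1 < j \<Longrightarrow> j \<le> N \<Longrightarrow> comm (e i (i + 1)) (e j (j + 1))"
    and serre: "1 \<le> i \<Longrightarrow> i + 1 \<le> N \<Longrightarrow> serre (e i (i + 1)) (e (i + 1) (i + 2))"
      "1 \<le> i \<Longrightarrow> i + 1 \<le> N \<Longrightarrow> serre (e (i + 1) (i + 2)) (e i (i + 1))"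
begin

lemma e_Suc: "i < j \<Longrightarrow> e i (Suc j) = br (e i j) (e j (Suc j))"
  using e_rec[of i "Suc j"] by simp

text \<open>Simple generators are peeled off one at a time by the recursion and combined by the
  Leibniz rule \<open>comm_br\<close>.\<close>

lemma comm_far_simple:
  assumes "Suc i \<le> j" "1 \<le> i" "j < m" "m \<le> N"
  shows "comm (e m (Suc m)) (e i j)"
  using assms
proof (induction j rule: dec_induct)
  case base
  then show ?case using far[of i m] by (auto intro: comm_sym)
next
  case (step j)
  then have "comm (e m (Suc m)) (e j (Suc j))"
    using far[of j m] by (auto intro: comm_sym)
  with step show ?case by (simp add: e_Suc comm_br)
qed

lemma comm_far:
  assumes "Suc m \<le> n" "1 \<le> i" "i < j" "j < m" "n \<le> N + 1"
  shows "comm (e i j) (e m n)"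
  using assms
proof (induction n rule: dec_induct)
  case base
  then show ?case using comm_far_simple[of i j m] by (auto intro: comm_sym)
next
  case (step n)
  then have "comm (e i j) (e n (Suc n))"
    using comm_far_simple[of i j n] by (auto intro: comm_sym)
  with step show ?case by (simp add: e_Suc comm_br)
qed

text \<open>The recursion splits off only the last simple generator. Since that generator commutes
  with x_ij, \<open>br_assoc\<close> moves the splitting point to any \<open>j\<close>.\<close>

lemma e_split:
  assumes "Suc j \<le> n" "1 \<le> i" "i < j" "n \<le> N + 1"
  shows "e i n - br (e i j) (e j n) \<in> I"
  using assms
proof (induction n rule: dec_induct)
  case base
  then show ?case by (simp add: e_Suc zero_mem)
next
  case (step n)
  let ?x = "e i j" and ?y = "e j n" and ?z = "e n (Suc n)"
  have "br (e i n) ?z - br (br ?x ?y) ?z \<in> I"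
    using step by (intro br_cong_left) auto
  moreover have "br (br ?x ?y) ?z - br ?x (br ?y ?z) \<in> I"
    using step by (intro br_assoc comm_far) auto
  ultimately have "(br (e i n) ?z - br (br ?x ?y) ?z) + (br (br ?x ?y) ?z - br ?x (br ?y ?z)) \<in> I"
    by (rule add_mem)
  with step show ?case by (simp add: e_Suc)
qed

text \<open>For \<open>n > j + 1\<close>, x_in is the bracket of \<open>e i (Suc j)\<close> and
  \<open>e (Suc j) n\<close>, and the second factor commutes with x_ij.\<close>

lemma qcomm_same_left_if_adjacent:
  assumes "qcomm (e i (Suc j)) (e i j)" "1 \<le> i" "i < j" "j < n" "n \<le> N + 1"
  shows "qcomm (e i n) (e i j)"
proof (cases "n = Suc j")
  case False
  have "comm (e (Suc j) n) (e i j)"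
    using assms False by (intro comm_sym[OF comm_far]) auto
  with assms(1) have "qcomm (br (e i (Suc j)) (e (Suc j) n)) (e i j)"
    by (rule qcomm_br_left1)
  with e_split[of "Suc j" n i] assms False show ?thesis
    by (auto intro: qcomm_cong_left)
qed (use assms in simp)

text \<open>Mirror image: x_in is split at \<open>m\<close>, and x_im commutes with
  \<open>e (Suc m) n\<close>.\<close>

lemma qcomm_same_right_if_adjacent:
  assumes "qcomm (e (Suc m) n) (e m n)" "1 \<le> i" "i \<le> m" "Suc m < n" "n \<le> N + 1"
  shows "qcomm (e (Suc m) n) (e i n)"
proof (cases "i = m")
  case False
  have "comm (e (Suc m) n) (e i m)"
    using assms False by (intro comm_sym[OF comm_far]) auto
  then have "qcomm (e (Suc m) n) (br (e i m) (e m n))"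
    using assms(1) by (rule qcomm_br_right2)
  with e_split[of m n i] assms False show ?thesis
    by (auto intro: qcomm_cong_right)
qed (use assms in simp)

lemma qcomm_same_left_simple:
  assumes "1 \<le> i" "Suc i < n" "n \<le> N + 1"
  shows "qcomm (e i n) (e i (Suc i))"
  by (rule qcomm_same_left_if_adjacent) (use assms serre(1)[of i] qcomm_br_left_iff_serre in \<open>auto simp: e_Suc\<close>)

lemma qcomm_same_right_simple:
  assumes "1 \<le> i" "i < m" "m \<le> N"
  shows "qcomm (e m (Suc m)) (e i (Suc m))"
proof -
  obtain k where k: "m = Suc k" using assms by (cases m) auto
  show ?thesis
    unfolding k by (rule qcomm_same_right_if_adjacent) (use assms serre(2)[of k] qcomm_br_right_iff_serre k in \<open>auto simp: e_Suc\<close>)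
qed

text \<open>Kept conditional on two q-commutations, so that it can be used within the inductions
  that establish q-commutation in general.\<close>

lemma comm_nested_if_qcomm:
  assumes "1 \<le> i" "i < m" "m < j" "j < n" "n \<le> N + 1"
    and "qcomm (e m j) (e i j)" "qcomm (e m n) (e m j)"
  shows "comm (e m j) (e i n)"
    and "e m n * e i j - e i j * e m n + (Q * Q - P * P) * e i n * e m j \<in> I"
proof -
  have "e i j - br (e i m) (e m j) \<in> I" "e m n - br (e m j) (e j n) \<in> I"
    "e i n - br (e i j) (e j n) \<in> I" "e i n - br (e i m) (e m n) \<in> I"
    using assms by (intro e_split; simp)+
  from comm_and_exchange[OF this assms(6,7)]
  show "comm (e m j) (e i n)"
    "e m n * e i j - e i j * e m n + (Q * Q - P * P) * e i n * e m j \<in> I" .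
qed

text \<open>In the induction step the smaller generator is expanded:
  \<open>e i (Suc (Suc j))\<close> q-commutes with its first factor by induction and commutes with
  the nested simple factor.\<close>

lemma qcomm_same_left_adjacent:
  assumes "Suc i \<le> j" "1 \<le> i" "j \<le> N"
  shows "qcomm (e i (Suc j)) (e i j)"
  using assms
proof (induction j rule: dec_induct)
  case base
  then show ?case using qcomm_same_left_simple[of i "Suc (Suc i)"] by simp
next
  case (step j)
  have "qcomm (e i (Suc (Suc j))) (e i j)"
    by (rule qcomm_same_left_if_adjacent) (use step in auto)
  \<comment> \<open>Both q-commutations required here involve the simple generator
    \<open>e j (Suc j)\<close>, so they are instances of the simple cases.\<close>
  moreover have "comm (e i (Suc (Suc j))) (e j (Suc j))"
    using step qcomm_same_right_simple[of i j] qcomm_same_left_simple[of j "Suc (Suc j)"]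
    by (intro comm_sym[OF comm_nested_if_qcomm(1)]) auto
  ultimately show ?case
    using step by (simp add: e_Suc[of i j] qcomm_br_right1)
qed

lemma qcomm_same_left:
  assumes "1 \<le> i" "i < j" "j < n" "n \<le> N + 1"
  shows "qcomm (e i n) (e i j)"
  by (rule qcomm_same_left_if_adjacent[OF qcomm_same_left_adjacent]) (use assms in auto)

text \<open>Mirror image, by induction on \<open>n - m\<close> because the left end moves. The
  recursion peels off on the right only, so \<open>e (Suc m) n\<close> is expanded at its left end
  by \<open>e_split\<close>, modulo the ideal.\<close>

lemma qcomm_same_right_adjacent:
  assumes "Suc m < n" "1 \<le> m" "n \<le> N + 1"
  shows "qcomm (e (Suc m) n) (e m n)"
  using assms
proof (induction "n - m" arbitrary: m)
  case (Suc k)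
  show ?case
  proof (cases "n = Suc (Suc m)")
    case True
    with Suc show ?thesis using qcomm_same_right_simple[of m "Suc m"] by simp
  next
    case False
    with Suc have "qcomm (e (Suc (Suc m)) n) (e (Suc m) n)"
      by (intro Suc.hyps(1)) auto
    then have "qcomm (e (Suc (Suc m)) n) (e m n)"
      by (rule qcomm_same_right_if_adjacent) (use Suc.prems False in auto)
    moreover have "comm (e (Suc m) (Suc (Suc m))) (e m n)"
      using Suc.prems False qcomm_same_right_simple[of m "Suc m"] qcomm_same_left_simple[of "Suc m" n]
      by (intro comm_nested_if_qcomm(1)) auto
    ultimately have "qcomm (br (e (Suc m) (Suc (Suc m))) (e (Suc (Suc m)) n)) (e m n)"
      by (intro qcomm_br_left2)
    with e_split[of "Suc (Suc m)" n "Suc m"] Suc.prems False show ?thesis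
      by (auto intro: qcomm_cong_left)
  qed
qed simp

lemma qcomm_same_right:
  assumes "1 \<le> i" "i < m" "m < n" "n \<le> N + 1"
  shows "qcomm (e m n) (e i n)"
proof -
  obtain k where k: "m = Suc k" using assms by (cases m) auto
  show ?thesis
    unfolding k by (rule qcomm_same_right_if_adjacent[OF qcomm_same_right_adjacent]) (use assms k in auto)
qed

lemma comm_nested:
  assumes "1 \<le> i" "i < m" "m < j" "j < n" "n \<le> N + 1"
  shows "comm (e m j) (e i n)"
  using assms by (intro comm_nested_if_qcomm(1) qcomm_same_left qcomm_same_right) auto

lemma exchange:
  assumes "1 \<le> i" "i < m" "m < j" "j < n" "n \<le> N + 1"
  shows "e m n * e i j - e i j * e m n + (Q * Q - P * P) * e i n * e m j \<in> I"
  using assms by (intro comm_nested_if_qcomm(2) qcomm_same_left qcomm_same_right) auto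

lemma q_bracket:
  assumes "1 \<le> i" "i < j" "j < n" "n \<le> N + 1"
  shows "e j n * e i j - Q * Q * e i j * e j n + Q * e i n \<in> I"
proof -
  have "e j n * e i j - Q * Q * e i j * e j n + Q * e i n = Q * (e i n - br (e i j) (e j n))"
    by (simp add: br_def q_simps)
  also have "\<dots> \<in> I"
    using e_split[of j n i] assms by (blast intro: mem_intros Suc_leI)
  finally show ?thesis
    .
qed

end

section \<open>Substitutions and isomorphisms of presented algebras\<close>

text \<open>The algebra homomorphism extending \<open>g\<close>, defined on the whole type so that
  no set of letters has to be fixed.\<close>

definition subst :: "('x \<Rightarrow> ('y, 'k::field) ncpoly) \<Rightarrow> ('x, 'k) ncpoly \<Rightarrow> ('y, 'k) ncpoly" where
  "subst g f = (\<Sum>v\<in>Poly_Mapping.keys f. const (Poly_Mapping.lookup f v) * prod_list (map g v))"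

lemma subst_superset:
  assumes "finite K" "Poly_Mapping.keys f \<subseteq> K"
  shows "subst g f = (\<Sum>v\<in>K. const (Poly_Mapping.lookup f v) * prod_list (map g v))"
  unfolding subst_def using assms
  by (intro sum.mono_neutral_left) (auto simp: in_keys_iff)

lemma subst_0 [simp]: "subst g 0 = 0"
  by (simp add: subst_def)

lemma subst_single: "subst g (Poly_Mapping.single v c) = const c * prod_list (map g v)"
  by (subst subst_superset[of "{v}"]) (auto split: if_splits)

lemma subst_add: "subst g (f + h) = subst g f + subst g h"
  using Poly_Mapping.keys_add[of f h]
  by (simp add: subst_superset[of "Poly_Mapping.keys f \<union> Poly_Mapping.keys h"] lookup_add const_add
      distrib_right sum.distrib)

lemma subst_sum: "subst g (\<Sum>i\<in>A. f i) = (\<Sum>i\<in>A. subst g (f i))"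
  by (induction A rule: infinite_finite_induct) (simp_all add: subst_add)

lemma subst_const [simp]: "subst g (const c) = const c"
  by (simp add: const_def subst_single)

lemma subst_gen [simp]: "subst g (gen x) = g x"
  by (simp add: gen_def word_def subst_single)

lemma subst_1 [simp]: "subst g 1 = 1"
  using subst_const[of g 1] by simp

lemma subst_mult: "subst g (f * h) = subst g f * subst g h"
proof -
  have *: "subst g (Poly_Mapping.single u c * Poly_Mapping.single v d) =
      subst g (Poly_Mapping.single u c) * subst g (Poly_Mapping.single v d)" for u v c d
    by (simp add: mult_single plus_list_def subst_single const_mult mult.assoc)
      (metis const_commute mult.assoc)
  \<comment> \<open>Stated for arbitrary \<open>A\<close>, \<open>B\<close>, \<open>F\<close> and
    \<open>G\<close>, because the expansion of \<open>f\<close> into its terms mentions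
    \<open>f\<close> again.\<close>
  have "subst g ((\<Sum>u\<in>A. Poly_Mapping.single u (F u)) * (\<Sum>v\<in>B. Poly_Mapping.single v (G v))) =
      subst g (\<Sum>u\<in>A. Poly_Mapping.single u (F u)) * subst g (\<Sum>v\<in>B. Poly_Mapping.single v (G v))"
    for A B and F G
    by (simp add: sum_product subst_sum *)
  from this[where A = "Poly_Mapping.keys f" and B = "Poly_Mapping.keys h"
      and F = "Poly_Mapping.lookup f" and G = "Poly_Mapping.lookup h"]
  show ?thesis
    unfolding poly_mapping_sum_single[symmetric] .
qed

lemma subst_uminus: "subst g (- f) = - subst g f"
proof -
  have "subst g (const (- 1) * f) = const (- 1) * subst g f"
    by (simp only: subst_mult subst_const)
  then show ?thesis by (simp add: const_uminus)
qed

lemma subst_diff: "subst g (f - h) = subst g f - subst g h"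
  using subst_add[of g f "- h"] by (simp add: subst_uminus)

section \<open>The free algebra on a set of letters and its ideals\<close>

lemma carrier_free_alg_iff: "f \<in> carrier (free_alg X) \<longleftrightarrow> Poly_Mapping.keys f \<subseteq> lists X"
  by (simp add: free_alg_def)

lemma carrier_mult: "f \<in> carrier (free_alg X) \<Longrightarrow> h \<in> carrier (free_alg X) \<Longrightarrow> f * h \<in> carrier (free_alg X)"
  using monoid.m_closed[OF ring.is_monoid[OF ring_free_alg], of f X h] by (simp add: free_alg_def)

lemma carrier_add: "f \<in> carrier (free_alg X) \<Longrightarrow> h \<in> carrier (free_alg X) \<Longrightarrow> f + h \<in> carrier (free_alg X)"
  using Poly_Mapping.keys_add[of f h] by (auto simp: carrier_free_alg_iff)

lemma carrier_diff:
  "f \<in> carrier (free_alg X) \<Longrightarrow> h \<in> carrier (free_alg X) \<Longrightarrow>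
    f - (h :: ('x, 'k::field) ncpoly) \<in> carrier (free_alg X)"
  using keys_diff[of f h] by (auto simp: carrier_free_alg_iff)

lemma carrier_const: "const c \<in> carrier (free_alg X)"
  by (simp add: carrier_free_alg_iff const_def)

lemma carrier_word: "w \<in> lists X \<Longrightarrow> word w \<in> carrier (free_alg X)"
  by (simp add: carrier_free_alg_iff word_def)

lemma carrier_gen: "x \<in> X \<Longrightarrow> gen x \<in> carrier (free_alg X)"
  by (simp add: gen_def carrier_word)

lemma carrier_1: "1 \<in> carrier (free_alg X)"
  using carrier_const[of 1 X] by simp

lemma carrier_0: "0 \<in> carrier (free_alg X)"
  by (simp add: carrier_free_alg_iff)

lemma carrier_sum: "(\<And>i. i \<in> A \<Longrightarrow> f i \<in> carrier (free_alg X)) \<Longrightarrow> sum f A \<in> carrier (free_alg X)"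
  by (induction A rule: infinite_finite_induct) (auto intro: carrier_add simp: carrier_0)

lemma carrier_subst:
  assumes "\<forall>x\<in>X. g x \<in> carrier (free_alg Y)" "f \<in> carrier (free_alg X)"
  shows "subst g f \<in> carrier (free_alg Y)"
proof -
  have "prod_list (map g v) \<in> carrier (free_alg Y)" if "v \<in> lists X" for v
    using that by (induction v) (use assms(1) in \<open>auto intro: carrier_mult carrier_1\<close>)
  moreover have "v \<in> lists X" if "v \<in> Poly_Mapping.keys f" for v
    using assms(2) that by (auto simp: carrier_free_alg_iff)
  ultimately show ?thesis
    unfolding subst_def by (intro carrier_sum carrier_mult carrier_const) auto
qed

lemmas carrier_intros = carrier_mult carrier_add carrier_diff carrier_const carrier_gen carrier_1

context
  fixes X :: "'x set" and S :: "('x, 'k::field) ncpoly set"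
  assumes S: "S \<subseteq> carrier (free_alg X)"
begin

lemma ideal_Id_gen: "ideal (Id_gen X S) (free_alg X)"
  unfolding Id_gen_def by (rule ring.genideal_ideal[OF ring_free_alg S])

lemma Id_gen_carrier: "f \<in> Id_gen X S \<Longrightarrow> f \<in> carrier (free_alg X)"
  using ideal.Icarr[OF ideal_Id_gen] .

lemma Id_gen_0: "0 \<in> Id_gen X S"
  using additive_subgroup.zero_closed[OF ideal.axioms(1)[OF ideal_Id_gen]] by (simp add: free_alg_def)

lemma Id_gen_add: "f \<in> Id_gen X S \<Longrightarrow> h \<in> Id_gen X S \<Longrightarrow> f + h \<in> Id_gen X S"
  using additive_subgroup.a_closed[OF ideal.axioms(1)[OF ideal_Id_gen], of f h] by (simp add: free_alg_def)

lemma Id_gen_mult_left: "f \<in> Id_gen X S \<Longrightarrow> h \<in> carrier (free_alg X) \<Longrightarrow> h * f \<in> Id_gen X S"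
  using ideal.I_l_closed[OF ideal_Id_gen, of f h] by (simp add: free_alg_def)

lemma Id_gen_mult_right: "f \<in> Id_gen X S \<Longrightarrow> h \<in> carrier (free_alg X) \<Longrightarrow> f * h \<in> Id_gen X S"
  using ideal.I_r_closed[OF ideal_Id_gen, of f h] by (simp add: free_alg_def)

lemma Id_gen_diff: 
  assumes "f \<in> Id_gen X S" "h \<in> Id_gen X S"
  shows "f - h \<in> Id_gen X S"
  using Id_gen_add[OF assms(1) Id_gen_mult_left[OF assms(2) carrier_const[of "- 1"]]]
  by (simp add: const_uminus)

lemma Id_gen_sum: "(\<And>i. i \<in> A \<Longrightarrow> f i \<in> Id_gen X S) \<Longrightarrow> sum f A \<in> Id_gen X S"
  by (induction A rule: infinite_finite_induct) (auto intro: Id_gen_add Id_gen_0)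

lemma Id_gen_incl: "s \<in> S \<Longrightarrow> s \<in> Id_gen X S"
  unfolding Id_gen_def using ring.genideal_self[OF ring_free_alg S] by auto

lemma cls_eq_iff:
  assumes "f \<in> carrier (free_alg X)" "h \<in> carrier (free_alg X)"
  shows "cls X S f = cls X S h \<longleftrightarrow> f - h \<in> Id_gen X S"
proof -
  have inv: "a_inv (free_alg X) h = - h"
    using assms(2) carrier_diff[OF carrier_const[of 0 X] assms(2)]
    by (intro abelian_group.minus_equality[OF ring.is_abelian_group[OF ring_free_alg]])
      (auto simp: free_alg_def)
  show ?thesis
    using ring.quotient_eq_iff_same_a_r_cos[OF ring_free_alg ideal_Id_gen assms]
    by (simp add: cls_def a_minus_def inv) (simp add: free_alg_def)
qed

lemma ring_pres_alg: "ring (pres_alg X S)"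
  unfolding pres_alg_def by (rule ideal.quotient_is_ring[OF ideal_Id_gen])

lemma cls_ring_hom: "cls X S \<in> ring_hom (free_alg X) (pres_alg X S)"
  using ideal.rcos_ring_hom[OF ideal_Id_gen] unfolding cls_def[abs_def] pres_alg_def .

lemma pres_alg_carrierE:
  assumes "c \<in> carrier (pres_alg X S)"
  obtains f where "f \<in> carrier (free_alg X)" "c = cls X S f"
  using assms by (auto simp: pres_alg_def FactRing_def A_RCOSETS_def' cls_def)

end

text \<open>A homomorphism congruent to the identity on letters is so on words, by induction on the
  length, and then on linear combinations.\<close>

lemma subst_subst_cong:
  fixes S :: "('a, 'b::field) ncpoly set"
  assumes "S \<subseteq> carrier (free_alg X)"
    and g: "\<forall>x\<in>X. g x \<in> carrier (free_alg Y)" and h: "\<forall>y\<in>Y. h y \<in> carrier (free_alg X)"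
    and inv: "\<forall>x\<in>X. subst h (g x) - gen x \<in> Id_gen X S"
    and f: "f \<in> carrier (free_alg X)"
  shows "subst h (subst g f) - f \<in> Id_gen X S"
proof -
  have word: "subst h (subst g (word v)) - word v \<in> Id_gen X S" if "v \<in> lists X" for v
    using that
  proof (induction v)
    case Nil
    then show ?case using Id_gen_0[OF assms(1)] by (simp add: word_Nil)
  next
    case (Cons x v)
    have "word (x # v) = (gen x * word v :: ('a, 'b) ncpoly)"
      by (simp add: gen_def word_mult)
    then have "subst h (subst g (word (x # v))) - word (x # v) =
        subst h (g x) * (subst h (subst g (word v)) - word v) + (subst h (g x) - gen x) * word v"
      by (simp add: subst_mult left_diff_distrib right_diff_distrib)
    also have "\<dots> \<in> Id_gen X S"
      using Cons g inv
      by (intro Id_gen_add Id_gen_mult_left Id_gen_mult_right assms(1)) (auto intro: carrier_subst[OF h] carrier_word)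
    finally show ?case .
  qed
  have eq: "(\<Sum>v\<in>Poly_Mapping.keys f. const (Poly_Mapping.lookup f v) * word v) = f"
    unfolding single_eq_const_word[symmetric] by (rule poly_mapping_sum_single[symmetric])
  have "subst h (subst g (\<Sum>v\<in>K. const (F v) * word v)) - (\<Sum>v\<in>K. const (F v) * word v) =
      (\<Sum>v\<in>K. const (F v) * (subst h (subst g (word v)) - word v))" for K F
    by (simp add: subst_sum subst_mult right_diff_distrib sum_subtractf)
  from this[where K = "Poly_Mapping.keys f" and F = "Poly_Mapping.lookup f"]
  have "subst h (subst g f) - f =
      (\<Sum>v\<in>Poly_Mapping.keys f. const (Poly_Mapping.lookup f v) * (subst h (subst g (word v)) - word v))"
    unfolding eq .
  also have "\<dots> \<in> Id_gen X S"
    using f by (intro Id_gen_sum Id_gen_mult_left assms(1) word carrier_const) (auto simp: carrier_free_alg_iff)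
  finally show ?thesis .
qed

section \<open>Homomorphisms and isomorphisms between presented algebras\<close>

lemma subst_ring_hom:
  assumes "\<forall>x\<in>X. g x \<in> carrier (free_alg Y)"
  shows "subst g \<in> ring_hom (free_alg X) (free_alg Y)"
proof (rule ring_hom_memI)
  show "subst g f \<in> carrier (free_alg Y)" if "f \<in> carrier (free_alg X)" for f
    by (rule carrier_subst[OF assms that])
qed (simp_all add: free_alg_def subst_mult subst_add)

lemma subst_pres_ring_hom_ring:
  assumes T: "T \<subseteq> carrier (free_alg Y)"
    and g: "\<forall>x\<in>X. g x \<in> carrier (free_alg Y)"
  shows "ring_hom_ring (free_alg X) (pres_alg Y T) (cls Y T \<circ> subst g)"
  using ring_hom_trans[OF subst_ring_hom[OF g] cls_ring_hom[OF T]]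
  by (intro ring_hom_ringI2 ring_free_alg ring_pres_alg T) auto

lemma a_kernel_subst:
  assumes T: "T \<subseteq> carrier (free_alg Y)"
    and g: "\<forall>x\<in>X. g x \<in> carrier (free_alg Y)"
  shows "a_kernel (free_alg X) (pres_alg Y T) (cls Y T \<circ> subst g) =
    {f \<in> carrier (free_alg X). subst g f \<in> Id_gen Y T}"
proof -
  have "\<zero>\<^bsub>pres_alg Y T\<^esub> = cls Y T 0"
    using ring_hom_zero[OF cls_ring_hom[OF T] ring_free_alg ring_pres_alg[OF T]] by (simp add: free_alg_def)
  then show ?thesis
    using cls_eq_iff[OF T carrier_subst[OF g], of _ 0]
    by (auto simp: a_kernel_def' carrier_free_alg_iff)
qed

text \<open>The kernel of the induced map into the quotient is an ideal containing \<open>S\<close>,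
  so it contains the ideal generated by \<open>S\<close>.\<close>

lemma subst_Id_gen:
  assumes S: "S \<subseteq> carrier (free_alg X)" and T: "T \<subseteq> carrier (free_alg Y)"
    and g: "\<forall>x\<in>X. g x \<in> carrier (free_alg Y)"
    and rel: "\<forall>s\<in>S. subst g s \<in> Id_gen Y T"
    and f: "f \<in> Id_gen X S"
  shows "subst g f \<in> Id_gen Y T"
proof -
  interpret ring_hom_ring "free_alg X" "pres_alg Y T" "cls Y T \<circ> subst g"
    by (rule subst_pres_ring_hom_ring[OF T g])
  have "Id_gen X S \<subseteq> {f \<in> carrier (free_alg X). subst g f \<in> Id_gen Y T}"
    unfolding Id_gen_def[of X] a_kernel_subst[OF T g, symmetric]
    by (rule ring.genideal_minimal[OF ring_free_alg kernel_is_ideal])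
      (use S rel a_kernel_subst[OF T g] in auto)
  with f show ?thesis by auto
qed

text \<open>First isomorphism theorem for the map induced by \<open>g\<close>. Applying
  \<open>h\<close> bounds its kernel by \<open>Id_gen X S\<close> and provides preimages for
  surjectivity.\<close>

lemma pres_alg_iso_if_inverse_subst:
  assumes S: "S \<subseteq> carrier (free_alg X)" and T: "T \<subseteq> carrier (free_alg Y)"
    and g: "\<forall>x\<in>X. g x \<in> carrier (free_alg Y)" and h: "\<forall>y\<in>Y. h y \<in> carrier (free_alg X)"
    and gS: "\<forall>s\<in>S. subst g s \<in> Id_gen Y T" and hT: "\<forall>t\<in>T. subst h t \<in> Id_gen X S"
    and hg: "\<forall>x\<in>X. subst h (g x) - gen x \<in> Id_gen X S"
    and gh: "\<forall>y\<in>Y. subst g (h y) - gen y \<in> Id_gen Y T"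
  obtains \<phi> where "\<phi> \<in> pres_alg_iso X S Y T"
    "\<And>f. f \<in> carrier (free_alg X) \<Longrightarrow> \<phi> (cls X S f) = cls Y T (subst g f)"
proof -
  define \<alpha> where "\<alpha> = cls Y T \<circ> subst g"
  interpret ring_hom_ring "free_alg X" "pres_alg Y T" \<alpha>
    unfolding \<alpha>_def by (rule subst_pres_ring_hom_ring[OF T g])
  have kernel: "a_kernel (free_alg X) (pres_alg Y T) \<alpha> = Id_gen X S"
    unfolding \<alpha>_def a_kernel_subst[OF T g]
  proof (intro equalityI subsetI)
    fix f assume "f \<in> {f \<in> carrier (free_alg X). subst g f \<in> Id_gen Y T}"
    then have f: "f \<in> carrier (free_alg X)" "subst h (subst g f) \<in> Id_gen X S"
      using subst_Id_gen[OF T S h hT] by auto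
    from Id_gen_diff[OF S f(2) subst_subst_cong[OF S g h hg f(1)]]
    show "f \<in> Id_gen X S" by simp
  qed (use subst_Id_gen[OF S T g gS] Id_gen_carrier[OF S] in auto)
  have "\<alpha> ` carrier (free_alg X) = carrier (pres_alg Y T)"
  proof (intro equalityI subsetI)
    fix c assume "c \<in> carrier (pres_alg Y T)"
    then obtain f where f: "f \<in> carrier (free_alg Y)" "c = cls Y T f"
      by (rule pres_alg_carrierE[OF T])
    have "subst h f \<in> carrier (free_alg X)"
      by (rule carrier_subst[OF h f(1)])
    moreover have "\<alpha> (subst h f) = c"
      unfolding \<alpha>_def f(2) comp_def
      using subst_subst_cong[OF T h g gh f(1)] f(1) calculation
      by (subst cls_eq_iff[OF T]) (auto intro: carrier_subst[OF g])
    ultimately show "c \<in> \<alpha> ` carrier (free_alg X)" by blast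
  qed auto
  from FactRing_iso_set[OF this]
  have iso: "(\<lambda>c. the_elem (\<alpha> ` c)) \<in> ring_iso (pres_alg X S) (pres_alg Y T)"
    by (simp add: kernel pres_alg_def[of X S])
  have val: "the_elem (\<alpha> ` cls X S f) = cls Y T (subst g f)" if "f \<in> carrier (free_alg X)" for f
    using the_elem_simp[OF that] unfolding kernel cls_def[symmetric] by (simp add: \<alpha>_def)
  show ?thesis
    by (rule that[of "\<lambda>c. the_elem (\<alpha> ` c)"])
      (use iso val in \<open>auto simp: pres_alg_iso_def carrier_const\<close>)
qed

text \<open>Pulling \<^term>\<open>Id_gen X S\<close> back along the retraction of the whole type onto the free algebra on
  \<open>X\<close> gives an ideal of the type, so that calculations need no carrier conditions.\<close>

definition Id_ext :: "'x set \<Rightarrow> ('x, 'k::field) ncpoly set \<Rightarrow> ('x, 'k) ncpoly set" where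
  "Id_ext X S = {f. subst (\<lambda>x. if x \<in> X then gen x else 0) f \<in> Id_gen X S}"

lemma prod_list_gen: "prod_list (map gen v) = (word v :: ('x, 'k::field) ncpoly)"
  by (induction v) (simp_all add: word_Nil gen_def word_mult)

lemma subst_gen_restrict:
  fixes f :: "('x, 'k::field) ncpoly"
  assumes "f \<in> carrier (free_alg X)"
  shows "subst (\<lambda>x. if x \<in> X then gen x else 0) f = f"
proof -
  have "prod_list (map (\<lambda>x. if x \<in> X then gen x else 0) v) = (word v :: ('x, 'k) ncpoly)"
    if "v \<in> Poly_Mapping.keys f" for v
  proof -
    have "map (\<lambda>x. if x \<in> X then gen x else 0) v = (map gen v :: ('x, 'k) ncpoly list)"
      using that assms by (auto simp: carrier_free_alg_iff)
    then show ?thesis by (simp only: prod_list_gen)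
  qed
  then have "subst (\<lambda>x. if x \<in> X then gen x else 0) f =
      (\<Sum>v\<in>Poly_Mapping.keys f. Poly_Mapping.single v (Poly_Mapping.lookup f v))"
    by (simp add: subst_def single_eq_const_word)
  then show ?thesis
    by (simp only: poly_mapping_sum_single[symmetric])
qed

context
  fixes X :: "'x set" and S :: "('x, 'k::field) ncpoly set"
  assumes S: "S \<subseteq> carrier (free_alg X)"
begin

lemma Id_ext_iff: "f \<in> carrier (free_alg X) \<Longrightarrow> f \<in> Id_ext X S \<longleftrightarrow> f \<in> Id_gen X S"
  by (simp add: Id_ext_def subst_gen_restrict)

lemma Id_ext_incl: "s \<in> S \<Longrightarrow> s \<in> Id_ext X S"
  using Id_ext_iff Id_gen_incl[OF S] S by blast

lemma two_sided_ideal_Id_ext: "two_sided_ideal (Id_ext X S)"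
proof -
  define \<pi> :: "('x, 'k) ncpoly \<Rightarrow> ('x, 'k) ncpoly"
    where "\<pi> = subst (\<lambda>x. if x \<in> X then gen x else 0)"
  have carrier: "\<pi> f \<in> carrier (free_alg X)" for f
  proof -
    have "prod_list (map (\<lambda>x. if x \<in> X then gen x else 0) v) \<in> carrier (free_alg X :: ('x, 'k) ncpoly ring)" for v
      by (induction v) (auto intro: carrier_intros carrier_0 simp: carrier_0)
    then show ?thesis
      unfolding \<pi>_def subst_def by (intro carrier_sum carrier_mult carrier_const)
  qed
  have mem: "f \<in> Id_ext X S \<longleftrightarrow> \<pi> f \<in> Id_gen X S" for f
    by (simp add: Id_ext_def \<pi>_def)
  have "\<pi> 0 = 0" "\<pi> (f + h) = \<pi> f + \<pi> h" "\<pi> (f * h) = \<pi> f * \<pi> h" for f h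
    by (simp_all add: \<pi>_def subst_add subst_mult)
  then show ?thesis
    by unfold_locales
      (simp_all add: mem Id_gen_0[OF S] Id_gen_add[OF S] Id_gen_mult_left[OF S] Id_gen_mult_right[OF S] carrier)
qed

lemma q_ideal_Id_ext:
  assumes "q \<noteq> 0" "q ^ 8 \<noteq> 1"
  shows "q_ideal (Id_ext X S) (const q) (const (inverse q)) (const (inverse (q * q + inverse q * inverse q)))"
proof -
  \<comment> \<open>If q^2 + q^-2 vanished, then q^4 = -1 and hence q^8 = 1.\<close>
  have "q * q + inverse q * inverse q \<noteq> 0"
  proof
    assume "q * q + inverse q * inverse q = 0"
    moreover have "q ^ 4 + 1 = (q * q + inverse q * inverse q) * q ^ 2"
      using assms(1) by (simp add: power2_eq_square power4_eq_xxxx field_simps)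
    ultimately have "q ^ 4 = - 1"
      by (simp add: eq_neg_iff_add_eq_0)
    then have "(q ^ 4) ^ 2 = 1" by simp
    with assms(2) show False by (simp flip: power_mult)
  qed
  then show ?thesis
    using assms(1)
    by (intro q_ideal.intro two_sided_ideal_Id_ext q_ideal_axioms.intro const_commute)
      (simp_all flip: const_mult const_add)
qed

end

section \<open>The isomorphism with the quantized enveloping algebra\<close>

lemma jimbo_gen_adjacent [simp]: "jimbo_gen q i (Suc i) = gen i"
  by (subst jimbo_gen.simps) simp

lemma jimbo_gen_rec:
  assumes "i + 1 < j"
  shows "jimbo_gen q i j = const q * jimbo_gen q i (j - 1) * jimbo_gen q (j - 1) j
    - const (inverse q) * jimbo_gen q (j - 1) j * jimbo_gen q i (j - 1)"
  using assms by (subst jimbo_gen.simps) simp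

lemma jimbo_gen_Suc:
  assumes "i < j"
  shows "jimbo_gen q i (Suc j) = const q * jimbo_gen q i j * gen j - const (inverse q) * gen j * jimbo_gen q i j"
  using jimbo_gen_rec[of i "Suc j" q] assms by simp

lemma jimbo_gen_carrier:
  assumes "Suc i \<le> j" "1 \<le> i" "j \<le> N + 1"
  shows "jimbo_gen q i j \<in> carrier (free_alg (uq_gens N))"
  using assms
proof (induction j rule: dec_induct)
  case base
  then show ?case by (simp add: carrier_gen uq_gens_def)
next
  case (step j)
  then have "gen j \<in> carrier (free_alg (uq_gens N))"
    by (intro carrier_gen) (simp add: uq_gens_def)
  with step show ?case by (auto simp: jimbo_gen_Suc intro!: carrier_diff carrier_mult carrier_const)
qed

lemma uq_rels_carrier: "uq_rels N q \<subseteq> carrier (free_alg (uq_gens N))"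
  unfolding uq_rels_def by (auto intro!: carrier_intros)

lemma const_sq_add:
  "const (q\<^sup>2 + inverse (q\<^sup>2)) = const q * const q + const (inverse q) * const (inverse (q :: 'k::field))"
  by (simp add: power2_eq_square const_add const_mult)

lemma const_sq_diff:
  "const (q\<^sup>2 - inverse (q\<^sup>2)) = const q * const q - const (inverse q) * const (inverse (q :: 'k::field))"
  by (simp add: power2_eq_square const_diff const_mult)

lemma const_sq: "const (q\<^sup>2) = const q * const q" "const (inverse (q\<^sup>2)) = const (inverse q) * const (inverse (q :: 'k::field))"
  by (simp_all add: power2_eq_square const_mult)

lemma jimbo_rels_hold:
  fixes q :: "'k::field"
  assumes "q \<noteq> 0" "q ^ 8 \<noteq> 1" "s \<in> jimbo_rels N q"
  shows "subst (\<lambda>(i, j). jimbo_gen q i j) s \<in> Id_gen (uq_gens N) (uq_rels N q)"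
proof -
  let ?I = "Id_ext (uq_gens N) (uq_rels N q)" and ?g = "\<lambda>(i, j). jimbo_gen q i j"
  interpret q_ideal ?I "const q" "const (inverse q)" "const (inverse (q * q + inverse q * inverse q))"
    by (rule q_ideal_Id_ext[OF uq_rels_carrier assms(1,2)])
  interpret uq_generators ?I "const q" "const (inverse q)" "const (inverse (q * q + inverse q * inverse q))"
    "jimbo_gen q" N
  proof
    fix i j :: nat
    show "jimbo_gen q i j = br (jimbo_gen q i (j - 1)) (jimbo_gen q (j - 1) j)" if "i + 1 < j"
      unfolding br_def by (rule jimbo_gen_rec[OF that])
    show "comm (jimbo_gen q i (i + 1)) (jimbo_gen q j (j + 1))" if "1 \<le> i" "i + 1 < j" "j \<le> N"
    proof -
      have "gen i * gen j - gen j * gen i \<in> uq_rels N q"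
        using that unfolding uq_rels_def uq_gens_def by (intro UnI2) force
      then show ?thesis
        unfolding comm_def by (simp add: Id_ext_incl[OF uq_rels_carrier])
    qed
    have serre: "serre (gen i) (gen j)"
      if "i \<in> uq_gens N" "j \<in> uq_gens N" "j = i + 1 \<or> i = j + 1" for i j
    proof -
      have "gen i * gen i * gen j - const (q^2 + inverse (q^2)) * gen i * gen j * gen i
        + gen j * gen i * gen i \<in> uq_rels N q"
        using that unfolding uq_rels_def by (intro UnI1) blast
      then show ?thesis
        unfolding serre_def const_sq_add[symmetric] by (rule Id_ext_incl[OF uq_rels_carrier])
    qed
    show "serre (jimbo_gen q i (i + 1)) (jimbo_gen q (i + 1) (i + 2))"
      "serre (jimbo_gen q (i + 1) (i + 2)) (jimbo_gen q i (i + 1))" if "1 \<le> i" "i + 1 \<le> N"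
      using that serre[of i "i + 1"] serre[of "i + 1" i] by (auto simp: uq_gens_def)
  qed
  \<comment> \<open>Lying in the free algebra on the given generators is what allows the return from
    \<open>Id_ext\<close> to \<open>Id_gen\<close> at the end.\<close>
  have "s \<in> carrier (free_alg (jimbo_vars N))"
    using jimbo_rels_carrier assms(3) by blast
  then have "subst ?g s \<in> carrier (free_alg (uq_gens N))"
    by (rule carrier_subst[rotated]) (auto simp: jimbo_vars_def intro: jimbo_gen_carrier)
  moreover have "subst ?g s \<in> ?I"
    using assms(3) unfolding jimbo_rels_def Un_iff mem_Collect_eq jimbo_vars_def case_prod_conv
  proof (elim disjE exE conjE)
    fix i j m n
    assume *: "1 \<le> i" "i < j" "j \<le> N + 1" "1 \<le> m" "m < n" "n \<le> N + 1"
    {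
      assume "s = gen (m, n) * gen (i, j) - const (inverse (q\<^sup>2)) * gen (i, j) * gen (m, n)"
      then have s: "subst ?g s = jimbo_gen q m n * jimbo_gen q i j
          - const (inverse q) * const (inverse q) * jimbo_gen q i j * jimbo_gen q m n"
        by (simp add: subst_diff subst_mult const_sq)
      show "subst ?g s \<in> ?I" if "i = m" "m < j" "j < n"
        using qcomm_same_left[of m j n] * that unfolding s qcomm_def by simp
      show "subst ?g s \<in> ?I" if "i < m" "m < j" "j = n"
        using qcomm_same_right[of i m n] * that unfolding s qcomm_def by simp
    }
    {
      assume "s = gen (m, n) * gen (i, j) - gen (i, j) * gen (m, n)"
      then have s: "subst ?g s = jimbo_gen q m n * jimbo_gen q i j - jimbo_gen q i j * jimbo_gen q m n"
        by (simp add: subst_diff subst_mult)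
      show "subst ?g s \<in> ?I" if "i < m" "m < n" "n < j"
        using comm_nested[of i m n j] * that unfolding s comm_def by simp
      show "subst ?g s \<in> ?I" if "i < j" "j < m" "m < n"
        using comm_sym[OF comm_far[of m n i j]] * that unfolding s comm_def by simp
    }
    {
      assume "s = gen (m, n) * gen (i, j) - gen (i, j) * gen (m, n)
        + const (q\<^sup>2 - inverse (q\<^sup>2)) * gen (i, n) * gen (m, j)"
      then have s: "subst ?g s = jimbo_gen q m n * jimbo_gen q i j - jimbo_gen q i j * jimbo_gen q m n
          + (const q * const q - const (inverse q) * const (inverse q)) * jimbo_gen q i n * jimbo_gen q m j"
        by (simp only: subst_diff subst_add subst_mult subst_const subst_gen const_sq_diff case_prod_conv)
      show "subst ?g s \<in> ?I" if "i < m" "m < j" "j < n"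
        using exchange[of i m j n] * that unfolding s by simp
    }
    {
      assume "s = gen (m, n) * gen (i, j) - const (q\<^sup>2) * gen (i, j) * gen (m, n) + const q * gen (i, n)"
      then have s: "subst ?g s = jimbo_gen q m n * jimbo_gen q i j
          - const q * const q * jimbo_gen q i j * jimbo_gen q m n + const q * jimbo_gen q i n"
        by (simp add: subst_diff subst_add subst_mult const_sq)
      show "subst ?g s \<in> ?I" if "i < j" "j = m" "m < n"
        using q_bracket[of i j n] * that unfolding s by simp
    }
  qed
  ultimately show ?thesis
    using Id_ext_iff[OF uq_rels_carrier] by blast
qed

section \<open>The Serre relations hold for the letters x_{i,i+1}\<close>

context
  fixes N :: nat and q :: "'k::field"
  assumes q: "q \<noteq> 0" "q ^ 8 \<noteq> 1"
begin

interpretation q_ideal "Id_ext (jimbo_vars N) (jimbo_rels N q)" "const q" "const (inverse q)"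
  "const (inverse (q * q + inverse q * inverse q))"
  by (rule q_ideal_Id_ext[OF jimbo_rels_carrier q])

lemma gen_split:
  assumes "1 \<le> i" "i < j" "j < n" "n \<le> N + 1"
  shows "gen (i, n) - br (gen (i, j)) (gen (j, n)) \<in> Id_ext (jimbo_vars N) (jimbo_rels N q)"
proof -
  let ?r = "gen (j, n) * gen (i, j) - const q * const q * gen (i, j) * gen (j, n) + const q * gen (i, n)"
  have "gen (j, n) * gen (i, j) - const (q\<^sup>2) * gen (i, j) * gen (j, n) + const q * gen (i, n) \<in> jimbo_rels N q"
    unfolding jimbo_rels_def by (intro UnI2) (use assms in \<open>force simp: jimbo_vars_def\<close>)
  then have "?r \<in> Id_ext (jimbo_vars N) (jimbo_rels N q)"
    unfolding const_sq by (rule Id_ext_incl[OF jimbo_rels_carrier])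
  moreover have "gen (i, n) - br (gen (i, j)) (gen (j, n)) = const (inverse q) * ?r"
    by (simp add: br_def q_simps)
  ultimately show ?thesis
    by (simp add: mult_left_mem)
qed

text \<open>The letter \<open>(i, i + 2)\<close> is congruent to the bracket of two adjacent simple
  letters; its q-commutations with these two letters are the two Serre relations.\<close>

lemma uq_rels_hold:
  assumes "t \<in> uq_rels N q"
  shows "subst (\<lambda>i. gen (i, Suc i)) t \<in> Id_gen (jimbo_vars N) (jimbo_rels N q)"
proof -
  let ?I = "Id_ext (jimbo_vars N) (jimbo_rels N q)"
  let ?x = "\<lambda>i. gen (i, Suc i) :: (nat \<times> nat, 'k) ncpoly"
  have serre_right: "serre (?x i) (?x (Suc i))" if i: "1 \<le> i" "Suc i \<le> N" for i
  proof -
    have "gen (i, i + 2) * ?x i - const (inverse (q\<^sup>2)) * ?x i * gen (i, i + 2) \<in> jimbo_rels N q"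
      unfolding jimbo_rels_def by (intro UnI1) (use i in \<open>force simp: jimbo_vars_def\<close>)
    then have "qcomm (gen (i, i + 2)) (?x i)"
      unfolding const_sq qcomm_def by (rule Id_ext_incl[OF jimbo_rels_carrier])
    moreover have "br (?x i) (?x (Suc i)) - gen (i, i + 2) \<in> ?I"
      using uminus_mem[OF gen_split[of i "Suc i" "i + 2"]] i by simp
    ultimately show ?thesis
      using qcomm_cong_left qcomm_br_left_iff_serre by blast
  qed
  have serre_left: "serre (?x (Suc i)) (?x i)" if i: "1 \<le> i" "Suc i \<le> N" for i
  proof -
    have "?x (Suc i) * gen (i, i + 2) - const (inverse (q\<^sup>2)) * gen (i, i + 2) * ?x (Suc i) \<in> jimbo_rels N q"
      unfolding jimbo_rels_def by (intro UnI1) (use i in \<open>force simp: jimbo_vars_def\<close>)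
    then have "qcomm (?x (Suc i)) (gen (i, i + 2))"
      unfolding const_sq qcomm_def by (rule Id_ext_incl[OF jimbo_rels_carrier])
    moreover have "br (?x i) (?x (Suc i)) - gen (i, i + 2) \<in> ?I"
      using uminus_mem[OF gen_split[of i "Suc i" "i + 2"]] i by simp
    ultimately show ?thesis
      using qcomm_cong_right qcomm_br_right_iff_serre by blast
  qed
  have far: "comm (?x j) (?x i)" if "1 \<le> i" "Suc i < j" "j \<le> N" for i j
  proof -
    have "?x j * ?x i - ?x i * ?x j \<in> jimbo_rels N q"
      unfolding jimbo_rels_def by (rule UnI1, rule UnI1, rule UnI2) (use that in \<open>force simp: jimbo_vars_def\<close>)
    then show ?thesis
      unfolding comm_def by (rule Id_ext_incl[OF jimbo_rels_carrier])
  qed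
  have "t \<in> carrier (free_alg (uq_gens N))"
    using uq_rels_carrier assms by blast
  then have "subst ?x t \<in> carrier (free_alg (jimbo_vars N))"
    by (rule carrier_subst[rotated]) (auto simp: jimbo_vars_def uq_gens_def intro: carrier_gen)
  moreover have "subst ?x t \<in> ?I"
    using assms unfolding uq_rels_def Un_iff mem_Collect_eq uq_gens_def
  proof (elim disjE exE conjE)
    fix i j
    assume *: "i \<in> {1..N}" "j \<in> {1..N}"
    {
      assume "t = gen i * gen i * gen j - const (q\<^sup>2 + inverse (q\<^sup>2)) * gen i * gen j * gen i
        + gen j * gen i * gen i"
      then have t: "subst ?x t \<in> ?I \<longleftrightarrow> serre (?x i) (?x j)"
        by (simp only: subst_add subst_diff subst_mult subst_const subst_gen serre_def const_sq_add)
      show "subst ?x t \<in> ?I" if "j = i + 1"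
        unfolding t using * that serre_right[of i] by simp
      show "subst ?x t \<in> ?I" if "i = j + 1"
        unfolding t using * that serre_left[of j] by simp
    }
    {
      assume "t = gen i * gen j - gen j * gen i"
      then have t: "subst ?x t \<in> ?I \<longleftrightarrow> comm (?x i) (?x j)"
        by (simp add: subst_diff subst_mult comm_def)
      show "subst ?x t \<in> ?I" if "i + 1 < j"
        unfolding t using * that comm_sym[OF far[of i j]] by simp
      show "subst ?x t \<in> ?I" if "j + 1 < i"
        unfolding t using * that far[of j i] by simp
    }
  qed
  ultimately show ?thesis
    using Id_ext_iff[OF jimbo_rels_carrier] by blast
qed

text \<open>Induction along the recursion: \<open>gen_split\<close> at the last index identifies
  each new bracket with a letter.\<close>

lemma subst_jimbo_gen:
  assumes "Suc i \<le> j" "1 \<le> i" "j \<le> N + 1"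
  shows "subst (\<lambda>i. gen (i, Suc i)) (jimbo_gen q i j) - gen (i, j) \<in> Id_ext (jimbo_vars N) (jimbo_rels N q)"
  using assms
proof (induction j rule: dec_induct)
  case base
  then show ?case by (simp add: zero_mem)
next
  case (step j)
  let ?h = "subst (\<lambda>i. gen (i, Suc i) :: (nat \<times> nat, 'k) ncpoly)"
  have "?h (jimbo_gen q i (Suc j)) = br (?h (jimbo_gen q i j)) (gen (j, Suc j))"
    using step by (simp add: jimbo_gen_Suc br_def subst_diff subst_mult)
  moreover have "br (?h (jimbo_gen q i j)) (gen (j, Suc j)) - br (gen (i, j)) (gen (j, Suc j))
      \<in> Id_ext (jimbo_vars N) (jimbo_rels N q)"
    using step by (intro br_cong_left) simp
  ultimately show ?case
    using diff_mem[OF _ gen_split[of i j "Suc j"]] step by fastforce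
qed

end

theorem theorem3p1:
  fixes N :: nat and q :: "'k::field"
  assumes "N \<ge> 1" and "q \<noteq> 0" and "q ^ 8 \<noteq> 1"
  shows "groebner_shirshov_basis (jimbo_vars N) (jimbo_rels N q)
    \<and> (\<exists>\<phi> \<in> pres_alg_iso (jimbo_vars N) (jimbo_rels N q) (uq_gens N) (uq_rels N q).
         \<forall>(i, j) \<in> jimbo_vars N.
           \<phi> (cls (jimbo_vars N) (jimbo_rels N q) (gen (i, j)))
             = cls (uq_gens N) (uq_rels N q) (jimbo_gen q i j))"
proof
  show "groebner_shirshov_basis (jimbo_vars N) (jimbo_rels N q)"
    by (rule groebner_shirshov_basis_jimbo_rels[OF assms(2)])
  let ?g = "\<lambda>(i, j). jimbo_gen q i j"
  let ?h = "\<lambda>i. gen (i, Suc i) :: (nat \<times> nat, 'k) ncpoly"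
  have g: "\<forall>x\<in>jimbo_vars N. ?g x \<in> carrier (free_alg (uq_gens N))"
    by (auto simp: jimbo_vars_def intro: jimbo_gen_carrier)
  have h: "\<forall>i\<in>uq_gens N. ?h i \<in> carrier (free_alg (jimbo_vars N))"
    by (auto simp: jimbo_vars_def uq_gens_def intro: carrier_gen)
  have hg: "\<forall>x\<in>jimbo_vars N. subst ?h (?g x) - gen x \<in> Id_gen (jimbo_vars N) (jimbo_rels N q)"
  proof
    fix x assume x: "x \<in> jimbo_vars N"
    then have "subst ?h (?g x) - gen x \<in> Id_ext (jimbo_vars N) (jimbo_rels N q)"
      using subst_jimbo_gen[OF assms(2,3), of "fst x" "snd x" N] by (auto simp: jimbo_vars_def)
    moreover have "subst ?h (?g x) - gen x \<in> carrier (free_alg (jimbo_vars N))"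
      using g x by (intro carrier_diff carrier_subst[OF h] carrier_gen) auto
    ultimately show "subst ?h (?g x) - gen x \<in> Id_gen (jimbo_vars N) (jimbo_rels N q)"
      using Id_ext_iff[OF jimbo_rels_carrier] by blast
  qed
  \<comment> \<open>Here the composite fixes generators exactly, because
    \<open>jimbo_gen q i (Suc i)\<close> is \<open>gen i\<close>.\<close>
  have gh: "\<forall>i\<in>uq_gens N. subst ?g (?h i) - gen i \<in> Id_gen (uq_gens N) (uq_rels N q)"
    by (simp add: Id_gen_0[OF uq_rels_carrier])
  obtain \<phi> where "\<phi> \<in> pres_alg_iso (jimbo_vars N) (jimbo_rels N q) (uq_gens N) (uq_rels N q)"
    and "\<And>f. f \<in> carrier (free_alg (jimbo_vars N)) \<Longrightarrow>
      \<phi> (cls (jimbo_vars N) (jimbo_rels N q) f) = cls (uq_gens N) (uq_rels N q) (subst ?g f)"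
    by (rule pres_alg_iso_if_inverse_subst[OF jimbo_rels_carrier uq_rels_carrier g h _ _ hg gh])
      (use jimbo_rels_hold[OF assms(2,3)] uq_rels_hold[OF assms(2,3)] in auto)
  then show "\<exists>\<phi> \<in> pres_alg_iso (jimbo_vars N) (jimbo_rels N q) (uq_gens N) (uq_rels N q).
      \<forall>(i, j) \<in> jimbo_vars N.
        \<phi> (cls (jimbo_vars N) (jimbo_rels N q) (gen (i, j)))
          = cls (uq_gens N) (uq_rels N q) (jimbo_gen q i j)"
    by (auto intro!: bexI[of _ \<phi>] simp: carrier_gen)
qed

end
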